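(* There exists a constant $K>0$ such that for every function $p=p(n)\in[0,1]$ with $p\ge \frac{K\log n}{n}$, the probability that $G^{n}_{n,p}$ contains a rainbow Hamilton cycle tends to $1$ as $n\to\infty$.
   Context: $G_{n,p}$ is the binomial random graph on vertex set $[n]$, in which each of the $\binom n2$ possible edges is present independently with probability $p$. For a positive integer $c$, $G^{c}_{n,p}$ denotes $G_{n,p}$ with each of its edges colored, independently and uniformly at random, with a color from $[c]=\{1,\dots,c\}$; thus $G^n_{n,p}$ uses $c=n$ colors. A Hamilton cycle in $G^c_{n,p}$ is rainbow if all its edges have pairwise distinct colors. *)

theory Defs
  imports "HOL-Probability.Probability" "HOL-Probability.Product_PMF"
begin

definition complete_edges :: "nat \<Rightarrow> nat set set" where
  "complete_edges n = {e. e \<subseteq> {1..n} \<and> card e = 2}"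

(* A graph on {1..n} is represented by its edge set. *)
definition binomial_graph :: "nat \<Rightarrow> real \<Rightarrow> nat set set pmf" where
  "binomial_graph n p =
     map_pmf (\<lambda>present. {e \<in> complete_edges n. present e})
       (Pi_pmf (complete_edges n) False (\<lambda>_. bernoulli_pmf p))"

(* An outcome is a pair of an edge set and a coloring; the coloring has the dummy
   value 0 outside the edge set. *)
definition colored_binomial_graph ::
    "nat \<Rightarrow> nat \<Rightarrow> real \<Rightarrow> (nat set set \<times> (nat set \<Rightarrow> nat)) pmf" where
  "colored_binomial_graph c n p =
     bind_pmf (binomial_graph n p) (\<lambda>E.
       map_pmf (\<lambda>col. (E, col)) (Pi_pmf E 0 (\<lambda>_. pmf_of_set {1..c})))"

definition cycle_edges :: "'a list \<Rightarrow> 'a set set" where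
  "cycle_edges vs = {{vs ! i, vs ! (Suc i mod length vs)} | i. i < length vs}"

definition hamilton_cycle :: "'a set \<Rightarrow> 'a set set \<Rightarrow> 'a set set \<Rightarrow> bool" where
  "hamilton_cycle V E H \<longleftrightarrow>
     (\<exists>vs. distinct vs \<and> set vs = V \<and> length vs \<ge> 3 \<and> H = cycle_edges vs \<and> H \<subseteq> E)"

definition rainbow :: "('e \<Rightarrow> 'c) \<Rightarrow> 'e set \<Rightarrow> bool" where
  "rainbow col H \<longleftrightarrow> inj_on col H"

definition has_rainbow_hamilton_cycle ::
    "nat \<Rightarrow> nat set set \<times> (nat set \<Rightarrow> nat) \<Rightarrow> bool" where
  "has_rainbow_hamilton_cycle n G \<longleftrightarrow>
     (\<exists>H. hamilton_cycle {1..n} (fst G) H \<and> rainbow (snd G) H)"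

end

theory Submission
  imports Defs
begin

text \<open>
  Rainbow Hamilton cycles are sets of \<open>n\<close> (edge, colour) pairs. A uniformly random one contains a
  given set of \<open>s\<close> pairs with probability at most \<open>(36 / n\<^sup>2)\<^sup>s\<close>, so this family is spread, and a
  random set of pairs of density of order \<open>log n / n\<^sup>2\<close> contains a member with high probability. The
  latter is shown in rounds: exposing a random set \<open>W\<close>, each member \<open>S\<close> is replaced by a smallest
  set \<open>S' - W\<close> with \<open>S' \<subseteq> W \<union> S\<close> a member. These fragments lie inside the members they replace, so
  they are again spread, and for most members the fragment has at most half the size.
  Finally, giving each present edge one uniform colour is at least as good as selecting
  (edge, colour) pairs independently, because no rainbow cycle uses two colours of one edge.
\<close>

subsection \<open>Averages over random subsets\<close>

text \<open>This is the expectation of \<open>f W\<close> when each element of the finite set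
  \<open>X\<close> enters \<open>W\<close> independently with probability \<open>p\<close>. As a
  finite sum it allows induction on \<open>X\<close>, and the algebraic identities below hold for
  every real \<open>p\<close>.\<close>

definition subset_mean :: "'a set \<Rightarrow> real \<Rightarrow> ('a set \<Rightarrow> real) \<Rightarrow> real" where
  "subset_mean X p f = (\<Sum>W\<in>Pow X. p ^ card W * (1 - p) ^ card (X - W) * f W)"

lemma subset_mean_empty [simp]: "subset_mean {} p f = f {}"
  by (simp add: subset_mean_def)

lemma subset_mean_insert:
  assumes "finite X" "x \<notin> X"
  shows "subset_mean (insert x X) p f =
    (1 - p) * subset_mean X p f + p * subset_mean X p (\<lambda>W. f (insert x W))"
proof -
  have fin: "finite W" if "W \<in> Pow X" for W
    using that assms(1) finite_subset by auto
  have disj: "Pow X \<inter> insert x ` Pow X = {}" and inj: "inj_on (insert x) (Pow X)"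
    using assms(2) by (auto simp: inj_on_def)
  have "(\<Sum>W\<in>Pow X. p ^ card W * (1 - p) ^ card (insert x X - W) * f W) = (1 - p) * subset_mean X p f"
    unfolding subset_mean_def sum_distrib_left
  proof (rule sum.cong)
    fix W assume W: "W \<in> Pow X"
    then have "insert x X - W = insert x (X - W)"
      using assms(2) by auto
    then show "p ^ card W * (1 - p) ^ card (insert x X - W) * f W =
        (1 - p) * (p ^ card W * (1 - p) ^ card (X - W) * f W)"
      using assms by simp
  qed simp
  moreover have "(\<Sum>W\<in>insert x ` Pow X. p ^ card W * (1 - p) ^ card (insert x X - W) * f W) =
      p * subset_mean X p (\<lambda>W. f (insert x W))"
    unfolding subset_mean_def sum_distrib_left sum.reindex[OF inj]
  proof (rule sum.cong)
    fix W assume W: "W \<in> Pow X"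
    then have "insert x X - insert x W = X - W" "x \<notin> W"
      using assms(2) by auto
    then show "((\<lambda>W. p ^ card W * (1 - p) ^ card (insert x X - W) * f W) \<circ> insert x) W =
        p * (p ^ card W * (1 - p) ^ card (X - W) * f (insert x W))"
      using fin[OF W] by simp
  qed simp
  ultimately show ?thesis
    unfolding subset_mean_def[of "insert x X"] Pow_insert
    using assms(1) disj by (subst sum.union_disjoint) auto
qed

lemma subset_mean_const [simp]: "finite X \<Longrightarrow> subset_mean X p (\<lambda>_. c) = c"
  by (induction X rule: finite_induct) (simp_all add: subset_mean_insert algebra_simps)

lemma subset_mean_add: "subset_mean X p (\<lambda>W. f W + g W) = subset_mean X p f + subset_mean X p g"
  by (simp add: subset_mean_def sum.distrib algebra_simps)

lemma subset_mean_diff: "subset_mean X p (\<lambda>W. f W - g W) = subset_mean X p f - subset_mean X p g"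
  by (simp add: subset_mean_def sum_subtractf algebra_simps)

lemma subset_mean_cmult: "subset_mean X p (\<lambda>W. c * f W) = c * subset_mean X p f"
  by (simp add: subset_mean_def sum_distrib_left algebra_simps)

lemma subset_mean_sum: "subset_mean X p (\<lambda>W. \<Sum>i\<in>I. f i W) = (\<Sum>i\<in>I. subset_mean X p (f i))"
  unfolding subset_mean_def sum_distrib_left by (rule sum.swap)

lemma subset_mean_mono:
  assumes "0 \<le> p" "p \<le> 1" "\<And>W. W \<subseteq> X \<Longrightarrow> f W \<le> g W"
  shows "subset_mean X p f \<le> subset_mean X p g"
  unfolding subset_mean_def using assms by (intro sum_mono mult_left_mono) auto

lemma subset_mean_Un:
  assumes "finite X" "finite Y" "X \<inter> Y = {}"
  shows "subset_mean (X \<union> Y) p f = subset_mean X p (\<lambda>W. subset_mean Y p (\<lambda>T. f (W \<union> T)))"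
  using assms(2,3)
proof (induction Y arbitrary: f rule: finite_induct)
  case (insert y Y)
  then show ?case
    using assms(1) by (simp add: subset_mean_insert subset_mean_add subset_mean_cmult)
qed simp

text \<open>Sprinkling: a point is missed by the union of two independent random sets exactly when
  both miss it, with probability \<open>(1 - p) * (1 - q)\<close>.\<close>

lemma subset_mean_two_rounds:
  assumes "finite X"
  shows "subset_mean X p (\<lambda>W. subset_mean X q (\<lambda>T. f (W \<union> T))) =
    subset_mean X (1 - (1 - p) * (1 - q)) f"
  using assms
proof (induction X arbitrary: f rule: finite_induct)
  case (insert x X)
  have "subset_mean X p (\<lambda>W. subset_mean X q (\<lambda>T. f (insert x (W \<union> T)))) =
      subset_mean X (1 - (1 - p) * (1 - q)) (\<lambda>W. f (insert x W))"
    using insert.IH[of "\<lambda>W. f (insert x W)"] by simp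
  with insert.IH[of f] insert.hyps have "subset_mean (insert x X) p (\<lambda>W. subset_mean (insert x X) q (\<lambda>T. f (W \<union> T))) =
      (1 - p) * ((1 - q) * subset_mean X (1 - (1 - p) * (1 - q)) f +
        q * subset_mean X (1 - (1 - p) * (1 - q)) (\<lambda>W. f (insert x W))) +
      p * ((1 - q) * subset_mean X (1 - (1 - p) * (1 - q)) (\<lambda>W. f (insert x W)) +
        q * subset_mean X (1 - (1 - p) * (1 - q)) (\<lambda>W. f (insert x W)))"
    by (simp add: subset_mean_insert subset_mean_add subset_mean_cmult) (simp add: algebra_simps)
  with insert.hyps show ?case
    by (simp add: subset_mean_insert algebra_simps)
qed simp

text \<open>Linearity of expectation. It later evaluates a union bound over the colours of one
  edge.\<close>

lemma subset_mean_sum_elements: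
  assumes "finite Y"
  shows "subset_mean Y p (\<lambda>T. \<Sum>y\<in>T. g y) = p * (\<Sum>y\<in>Y. g y)"
  using assms
proof (induction Y rule: finite_induct)
  case (insert y Y)
  have "subset_mean Y p (\<lambda>T. \<Sum>z\<in>insert y T. g z) = subset_mean Y p (\<lambda>T. g y + (\<Sum>z\<in>T. g z))"
    unfolding subset_mean_def
  proof (intro sum.cong refl)
    fix T assume "T \<in> Pow Y"
    with insert.hyps have "finite T" "y \<notin> T"
      using finite_subset by auto
    then show "p ^ card T * (1 - p) ^ card (Y - T) * sum g (insert y T) =
        p ^ card T * (1 - p) ^ card (Y - T) * (g y + sum g T)"
      by simp
  qed
  with insert show ?case
    by (simp add: subset_mean_insert subset_mean_add algebra_simps)
qed simp

subsection \<open>Spread families and fragments\<close>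

text \<open>With \<open>N = card I\<close>, a uniformly random member contains \<open>S\<close> with
  probability at most \<open>\<kappa>\<close> to the power \<open>- card S\<close>. Members are
  counted by index, because different members may have the same fragment.\<close>

definition spread :: "'i set \<Rightarrow> ('i \<Rightarrow> 'a set) \<Rightarrow> real \<Rightarrow> real \<Rightarrow> bool" where
  "spread I A N \<kappa> \<longleftrightarrow>
    (\<forall>S. finite S \<longrightarrow> real (card {i \<in> I. S \<subseteq> A i}) \<le> N / \<kappa> ^ card S)"

definition hit_mean :: "'a set \<Rightarrow> real \<Rightarrow> 'i set \<Rightarrow> ('i \<Rightarrow> 'a set) \<Rightarrow> real" where
  "hit_mean X p I A = subset_mean X p (\<lambda>W. of_bool (\<exists>i\<in>I. A i \<subseteq> W))"

section \<open>Minimal fragments relative to an exposed set\<close>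

definition fragment_index :: "'i set \<Rightarrow> ('i \<Rightarrow> 'a set) \<Rightarrow> 'a set \<Rightarrow> 'i \<Rightarrow> 'i" where
  "fragment_index I A W i = arg_min (\<lambda>j. card (A j - W)) (\<lambda>j. j \<in> I \<and> A j \<subseteq> W \<union> A i)"

definition fragment :: "'i set \<Rightarrow> ('i \<Rightarrow> 'a set) \<Rightarrow> 'a set \<Rightarrow> 'i \<Rightarrow> 'a set" where
  "fragment I A W i = A (fragment_index I A W i) - W"

lemma fragment_index:
  assumes "i \<in> I"
  shows "fragment_index I A W i \<in> I" "A (fragment_index I A W i) \<subseteq> W \<union> A i"
    and "\<And>j. j \<in> I \<Longrightarrow> A j \<subseteq> W \<union> A i \<Longrightarrow> card (fragment I A W i) \<le> card (A j - W)"
proof -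
  have i: "i \<in> I \<and> A i \<subseteq> W \<union> A i"
    using assms by auto
  show "fragment_index I A W i \<in> I" "A (fragment_index I A W i) \<subseteq> W \<union> A i"
    using arg_min_natI[of "\<lambda>j. j \<in> I \<and> A j \<subseteq> W \<union> A i", OF i]
    unfolding fragment_index_def by auto
  show "card (fragment I A W i) \<le> card (A j - W)" if "j \<in> I" "A j \<subseteq> W \<union> A i" for j
    unfolding fragment_def fragment_index_def
    using arg_min_nat_le[of "\<lambda>j. j \<in> I \<and> A j \<subseteq> W \<union> A i" j "\<lambda>j. card (A j - W)"] that by auto
qed

lemma fragment_subset: "i \<in> I \<Longrightarrow> fragment I A W i \<subseteq> A i"
  using fragment_index(2)[of i I A W] unfolding fragment_def by auto

text \<open>
  The set \<open>Z = W \<union> T\<close> together with a member of the family chosen inside \<open>Z\<close> leaves few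
  possibilities for the fragment \<open>T\<close>: minimality forces \<open>T\<close> into every such member.
\<close>

lemma fragment_subset_member:
  assumes "i \<in> I" "j \<in> I" "finite (A i)" "A j \<subseteq> W \<union> fragment I A W i"
  shows "fragment I A W i \<subseteq> A j"
proof -
  have sub: "A j - W \<subseteq> fragment I A W i"
    using assms(4) by auto
  have fin: "finite (fragment I A W i)"
    using fragment_subset[OF assms(1)] assms(3) by (rule finite_subset)
  have "A j \<subseteq> W \<union> A i"
    using assms(4) fragment_subset[OF assms(1), of A W] by auto
  then have "card (fragment I A W i) \<le> card (A j - W)"
    by (rule fragment_index(3)[OF assms(1,2)])
  then have "A j - W = fragment I A W i"
    using card_seteq[OF fin sub] by simp
  then show ?thesis by auto
qed

text \<open>Double counting of the pairs \<open>(W, i)\<close> with a large fragment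
  \<open>T\<close>. Such a pair is encoded by \<open>Z = W \<union> T\<close>, \<open>T\<close> and
  \<open>i\<close>. Given \<open>Z\<close>, there are at most \<open>2 ^ r\<close> candidates for
  \<open>T\<close>, namely the subsets of one member chosen inside \<open>Z\<close>; spread leaves
  at most \<open>N / \<kappa> ^ card T\<close> indices. Passing from the weight of \<open>W\<close>
  to that of \<open>Z\<close> costs at most \<open>(1 / p) ^ card T\<close>.\<close>

lemma fragment_mean_le:
  fixes p \<kappa> N :: real
  assumes X: "finite X" and I: "finite I" and A: "\<And>i. i \<in> I \<Longrightarrow> A i \<subseteq> X \<and> card (A i) \<le> r"
    and sp: "spread I A N \<kappa>" and p: "0 < p" "p \<le> 1" and L: "1 \<le> p * \<kappa>" and N: "0 \<le> N"
  shows "subset_mean X p (\<lambda>W. real (card {i \<in> I. m < card (fragment I A W i)}))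
    \<le> N * 2 ^ r / (p * \<kappa>) ^ Suc m"
proof -
  define w where "w W = p ^ card W * (1 - p) ^ card (X - W)" for W :: "'a set"
  define T where "T = fragment I A"
  \<comment> \<open>The choice depends on \<open>Z\<close> alone. The default \<open>{}\<close> is
    not met for \<open>Z = W \<union> T W i\<close> with \<open>i \<in> I\<close>, since such a set
    contains a member.\<close>
  define M where "M Z = (if \<exists>j\<in>I. A j \<subseteq> Z then A (SOME j. j \<in> I \<and> A j \<subseteq> Z) else {})" for Z
  have M_mem: "(\<exists>j\<in>I. M Z = A j) \<or> M Z = {}" for Z
    using someI_ex[of "\<lambda>j. j \<in> I \<and> A j \<subseteq> Z"] unfolding M_def by auto
  have M: "M Z \<subseteq> X" "card (M Z) \<le> r" for Z
    using A M_mem[of Z] by auto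
  have finM: "finite (M Z)" for Z
    using M(1) X by (rule finite_subset)
  have finS: "finite {S \<in> Pow (M Z). m < card S}" for Z
    using finM[of Z] by simp
  have finA: "finite (A i)" if "i \<in> I" for i
    using A[OF that] X by (auto intro: finite_subset)
  have TM: "T W i \<subseteq> M (W \<union> T W i)" if "i \<in> I" for W i
  proof -
    have k: "fragment_index I A W i \<in> I \<and> A (fragment_index I A W i) \<subseteq> W \<union> T W i"
      using fragment_index(1,2)[OF that, of A W] unfolding T_def fragment_def by auto
    obtain j where j: "j = (SOME j. j \<in> I \<and> A j \<subseteq> W \<union> T W i)" by simp
    have "j \<in> I \<and> A j \<subseteq> W \<union> T W i"
      unfolding j by (rule someI[of _ "fragment_index I A W i"]) (use k in simp)
    then have "T W i \<subseteq> A j"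
      using fragment_subset_member[of i I j A W] that finA[OF that] unfolding T_def by blast
    moreover have "M (W \<union> T W i) = A j"
      unfolding M_def j using k by auto
    ultimately show ?thesis by simp
  qed
  \<comment> \<open>\<open>B\<close> holds the pairs to be counted, \<open>D\<close> the admissible
    codes, \<open>\<phi>\<close> is the encoding, and \<open>h\<close> is the weight charged to a
    code.\<close>
  define B where "B = (SIGMA W:Pow X. {i \<in> I. m < card (T W i)})"
  define D where "D = (SIGMA Z:Pow X. SIGMA S:{S \<in> Pow (M Z). m < card S}. {i \<in> I. S \<subseteq> A i})"
  define \<phi> where "\<phi> = (\<lambda>(W, i). (W \<union> T W i, T W i, i))"
  define h where "h = (\<lambda>(Z, S :: 'a set, i::'b). w Z * (1 / p) ^ card S)"
  have finD: "finite D"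
    unfolding D_def using X I finS by (intro finite_SigmaI) auto
  have TW: "T W i \<inter> W = {}" for W i
    unfolding T_def fragment_def by auto
  have TX: "T W i \<subseteq> X" if "i \<in> I" for W i
    using fragment_subset[OF that, of A W] A[OF that] unfolding T_def by auto
  have "subset_mean X p (\<lambda>W. real (card {i \<in> I. m < card (T W i)})) = (\<Sum>(W, i)\<in>B. w W)"
    unfolding subset_mean_def B_def w_def using X I
    by (subst sum.Sigma[symmetric]) (auto simp: algebra_simps)
  also have "\<dots> \<le> (\<Sum>x\<in>B. h (\<phi> x))"
  proof (rule sum_mono, clarify)
    fix W i assume "(W, i) \<in> B"
    then have W: "W \<subseteq> X" and i: "i \<in> I" unfolding B_def by auto
    have fin: "finite W" "finite (T W i)"
      using W TX[OF i] X by (auto intro: finite_subset)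
    have "card (W \<union> T W i) = card W + card (T W i)"
      using fin TW[of W i] by (subst card_Un_disjoint) auto
    moreover have "card (X - W) = card (X - (W \<union> T W i)) + card (T W i)"
    proof -
      have "X - W = (X - (W \<union> T W i)) \<union> T W i"
        using TX[OF i, of W] TW[of W i] by auto
      then show ?thesis
        using X fin card_Un_disjoint[of "X - (W \<union> T W i)" "T W i"] by auto
    qed
    \<comment> \<open>Moving \<open>T\<close> into the exposed set trades factors
      \<open>1 - p\<close> for factors \<open>p\<close>. Keeping
      \<open>(1 - p) ^ card (T W i)\<close> as a factor avoids dividing by \<open>1 - p\<close>, so
      \<open>p = 1\<close> is covered.\<close>
    ultimately have "w W = w (W \<union> T W i) * (1 / p) ^ card (T W i) * (1 - p) ^ card (T W i)"
      unfolding w_def using p(1) by (simp add: power_add power_divide)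
    also have "\<dots> \<le> w (W \<union> T W i) * (1 / p) ^ card (T W i) * 1"
      using p unfolding w_def by (intro mult_left_mono power_le_one) auto
    finally show "w W \<le> h (\<phi> (W, i))"
      unfolding h_def \<phi>_def by simp
  qed
  also have "\<dots> = (\<Sum>x\<in>\<phi> ` B. h x)"
  proof -
    \<comment> \<open>A fragment is disjoint from \<open>W\<close>, so \<open>W\<close> is recovered
      as \<open>Z - T\<close>.\<close>
    have "inj_on \<phi> B"
    proof (rule inj_onI, clarify)
      fix W i W' i' assume "\<phi> (W, i) = \<phi> (W', i')"
      then have eq: "W \<union> T W i = W' \<union> T W' i'" "T W i = T W' i'" "i = i'"
        unfolding \<phi>_def by auto
      then have "W = (W \<union> T W i) - T W i" "W' = (W \<union> T W i) - T W i"
        using TW[of W i] TW[of W' i'] by auto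
      with eq(3) show "W = W' \<and> i = i'" by simp
    qed
    then show ?thesis by (simp add: sum.reindex)
  qed
  also have "\<dots> \<le> (\<Sum>x\<in>D. h x)"
  proof (rule sum_mono2[OF finD])
    show "\<phi> ` B \<subseteq> D"
    proof (rule image_subsetI)
      fix x assume "x \<in> B"
      then obtain W i where x: "x = (W, i)" "W \<subseteq> X" "i \<in> I" "m < card (T W i)"
        unfolding B_def by auto
      have "T W i \<subseteq> A i"
        using fragment_subset[OF x(3)] unfolding T_def .
      with x TX[OF x(3), of W] TM[OF x(3), of W] show "\<phi> x \<in> D"
        unfolding \<phi>_def D_def by simp
    qed
    show "0 \<le> h x" for x
      using p unfolding h_def w_def by (auto split: prod.splits)
  qed
  also have "\<dots> = (\<Sum>Z\<in>Pow X. \<Sum>S\<in>{S \<in> Pow (M Z). m < card S}.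
      w Z * ((1 / p) ^ card S * real (card {i \<in> I. S \<subseteq> A i})))"
  proof -
    have "(\<Sum>x\<in>D. h x) = (\<Sum>Z\<in>Pow X. \<Sum>(S, i)\<in>(SIGMA S:{S \<in> Pow (M Z). m < card S}. {i \<in> I. S \<subseteq> A i}). h (Z, S, i))"
      unfolding D_def using X I finS by (subst sum.Sigma) (auto intro!: sum.cong finite_SigmaI)
    also have "\<dots> = (\<Sum>Z\<in>Pow X. \<Sum>S\<in>{S \<in> Pow (M Z). m < card S}. \<Sum>i\<in>{i \<in> I. S \<subseteq> A i}. h (Z, S, i))"
      using I finS by (intro sum.cong refl sum.Sigma[symmetric]) auto
    finally show ?thesis
      by (simp add: h_def algebra_simps)
  qed
  also have "\<dots> \<le> (\<Sum>Z\<in>Pow X. \<Sum>S\<in>{S \<in> Pow (M Z). m < card S}. w Z * (N / (p * \<kappa>) ^ Suc m))"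
  proof (intro sum_mono mult_left_mono)
    fix Z S assume "Z \<in> Pow X" and S: "S \<in> {S \<in> Pow (M Z). m < card S}"
    then have "finite S"
      using M(1)[of Z] X by (auto intro: finite_subset)
    then have "(1 / p) ^ card S * real (card {i \<in> I. S \<subseteq> A i}) \<le> (1 / p) ^ card S * (N / \<kappa> ^ card S)"
      using sp p unfolding spread_def by (intro mult_left_mono) auto
    also have "\<dots> = N / (p * \<kappa>) ^ card S"
      by (simp add: power_divide power_mult_distrib)
    also have "\<dots> \<le> N / (p * \<kappa>) ^ Suc m"
    proof -
      have "(p * \<kappa>) ^ Suc m \<le> (p * \<kappa>) ^ card S"
        using L S by (intro power_increasing) auto
      moreover have "0 < (p * \<kappa>) ^ Suc m"
        using L by (intro zero_less_power) auto
      ultimately show ?thesis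
        using N by (intro divide_left_mono mult_pos_pos) auto
    qed
    finally show "(1 / p) ^ card S * real (card {i \<in> I. S \<subseteq> A i}) \<le> N / (p * \<kappa>) ^ Suc m" .
    show "0 \<le> w Z" unfolding w_def using p by simp
  qed
  also have "\<dots> \<le> (\<Sum>Z\<in>Pow X. w Z * (2 ^ r * (N / (p * \<kappa>) ^ Suc m)))"
  proof (rule sum_mono)
    fix Z assume "Z \<in> Pow X"
    have "card {S \<in> Pow (M Z). m < card S} \<le> card (Pow (M Z))"
      using finM[of Z] by (intro card_mono) auto
    also have "\<dots> \<le> 2 ^ r"
      using finM[of Z] M(2)[of Z] by (simp add: card_Pow power_increasing)
    finally have "real (card {S \<in> Pow (M Z). m < card S}) \<le> 2 ^ r"
      by (metis of_nat_le_iff of_nat_numeral of_nat_power)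
    moreover have "0 \<le> w Z * (N / (p * \<kappa>) ^ Suc m)"
      unfolding w_def using p N zero_less_mult_pos[OF less_le_trans[OF zero_less_one L] p(1)] by simp
    ultimately have "real (card {S \<in> Pow (M Z). m < card S}) * (w Z * (N / (p * \<kappa>) ^ Suc m))
        \<le> 2 ^ r * (w Z * (N / (p * \<kappa>) ^ Suc m))"
      by (rule mult_right_mono)
    then show "(\<Sum>S\<in>{S \<in> Pow (M Z). m < card S}. w Z * (N / (p * \<kappa>) ^ Suc m))
        \<le> w Z * (2 ^ r * (N / (p * \<kappa>) ^ Suc m))"
      by (simp only: sum_constant mult.left_commute)
  qed
  also have "\<dots> = subset_mean X p (\<lambda>_. 2 ^ r * (N / (p * \<kappa>) ^ Suc m))"
    unfolding subset_mean_def w_def ..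
  also have "\<dots> = N * 2 ^ r / (p * \<kappa>) ^ Suc m"
    using X by simp
  finally show ?thesis
    unfolding T_def .
qed

text \<open>
  \<open>hits X N \<kappa> r q \<delta>\<close>: densities at least \<open>q\<close> suffice for every \<open>\<kappa>\<close>-spread family of sets of
  size at most \<open>r\<close>, up to an error \<open>\<delta>\<close>. The normalisation \<open>N\<close> stays that of the initial family,
  so that discarding members shows up as a loss in \<open>card I / N\<close> and not in the spread.
\<close>

definition hits :: "'i itself \<Rightarrow> 'a set \<Rightarrow> real \<Rightarrow> real \<Rightarrow> nat \<Rightarrow> real \<Rightarrow> real \<Rightarrow> bool" where
  "hits _ X N \<kappa> r q \<delta> \<longleftrightarrow>
    (\<forall>(I::'i set) A q'. finite I \<longrightarrow> (\<forall>i\<in>I. A i \<subseteq> X \<and> card (A i) \<le> r) \<longrightarrow> spread I A N \<kappa> \<longrightarrow>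
      q \<le> q' \<longrightarrow> q' \<le> 1 \<longrightarrow> card I / N - \<delta> \<le> hit_mean X q' I A)"

section \<open>Iterated exposure down to logarithmic density\<close>

lemma hits_0:
  assumes "finite X" "0 < N"
  shows "hits TYPE('i) X N \<kappa> 0 0 0"
  unfolding hits_def
proof (intro allI impI)
  fix I :: "'i set" and A :: "'i \<Rightarrow> 'a set" and q' :: real
  assume *: "finite I" "\<forall>i\<in>I. A i \<subseteq> X \<and> card (A i) \<le> 0" "spread I A N \<kappa>" "0 \<le> q'"
  have A: "A i = {}" if "i \<in> I" for i
    using *(2) that assms(1) finite_subset[of "A i" X] by auto
  then have "(\<exists>i\<in>I. A i \<subseteq> W) \<longleftrightarrow> I \<noteq> {}" for W
    by auto
  then have "hit_mean X q' I A = of_bool (I \<noteq> {})"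
    using assms(1) by (simp add: hit_mean_def)
  \<comment> \<open>Spread at the empty set bounds the size of the family by \<open>N\<close>, so
    the required bound is at most 1, and at most 0 when \<open>I\<close> is empty.\<close>
  moreover have "card {i \<in> I. {} \<subseteq> A i} \<le> N / \<kappa> ^ card ({} :: 'a set)"
    using *(3) unfolding spread_def by blast
  then have "card I \<le> N"
    by simp
  ultimately show "card I / N - 0 \<le> hit_mean X q' I A"
    using assms(2) by auto
qed

text \<open>After a first round \<open>W\<close> of density \<open>p\<close>, the members whose
  fragment exceeds \<open>m\<close> are discarded; on average this loses at most the new error term.
  The other fragments form a spread family of smaller sets, to which the hypothesis applies in an
  independent second round.\<close>

lemma hits_step:
  fixes p q \<kappa> \<delta> N :: real
  assumes X: "finite X" and N: "0 < N" and p: "0 < p" "p < 1" and L: "1 \<le> p * \<kappa>"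
    and q: "0 \<le> q" and hits: "hits TYPE('i) X N \<kappa> m q \<delta>"
  shows "hits TYPE('i) X N \<kappa> r (p + q) (\<delta> + 2 ^ r / (p * \<kappa>) ^ Suc m)"
  unfolding hits_def
proof (intro allI impI)
  fix I :: "'i set" and A :: "'i \<Rightarrow> 'a set" and q' :: real
  assume I: "finite I" and A: "\<forall>i\<in>I. A i \<subseteq> X \<and> card (A i) \<le> r" and sp: "spread I A N \<kappa>"
    and q': "p + q \<le> q'" "q' \<le> 1"
  \<comment> \<open>The density of the second round is chosen so that the union of both rounds has
    density exactly \<open>q'\<close>.\<close>
  define q1 where "q1 = 1 - (1 - q') / (1 - p)"
  have q1: "q \<le> q1" "q1 \<le> 1" "1 - (1 - p) * (1 - q1) = q'"
  proof -
    have "1 - q' \<le> (1 - q) * (1 - p)"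
      using q' q p by (simp add: algebra_simps) (smt (verit) mult_nonneg_nonneg)
    then have "(1 - q') / (1 - p) \<le> 1 - q"
      using p by (simp add: pos_divide_le_eq)
    then show "q \<le> q1" unfolding q1_def by simp
    show "q1 \<le> 1" "1 - (1 - p) * (1 - q1) = q'"
      using q' p unfolding q1_def by (auto simp: field_simps)
  qed
  define J where "J W = {i \<in> I. \<not> m < card (fragment I A W i)}" for W
  let ?bad = "\<lambda>W. real (card {i \<in> I. m < card (fragment I A W i)})"
  have J: "card (J W) = card I - ?bad W" for W
  proof -
    have "card (J W) + card {i \<in> I. m < card (fragment I A W i)} = card I"
      unfolding J_def using I by (subst card_Un_disjoint[symmetric]) (auto intro: arg_cong[where f = card])
    then show ?thesis by linarith
  qed
  have "card I / N - (\<delta> + 2 ^ r / (p * \<kappa>) ^ Suc m) \<le>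
      card I / N - \<delta> - subset_mean X p ?bad / N"
  proof -
    have "subset_mean X p ?bad \<le> N * 2 ^ r / (p * \<kappa>) ^ Suc m"
      using fragment_mean_le[OF X I _ sp p(1) less_imp_le[OF p(2)] L] A N by auto
    then have "subset_mean X p ?bad / N \<le> (N * 2 ^ r / (p * \<kappa>) ^ Suc m) / N"
      using N by (intro divide_right_mono) auto
    also have "\<dots> = 2 ^ r / (p * \<kappa>) ^ Suc m"
      using N by simp
    finally show ?thesis by simp
  qed
  also have "\<dots> = subset_mean X p (\<lambda>W. card I / N - \<delta> - (1 / N) * ?bad W)"
    using X by (simp only: subset_mean_diff subset_mean_cmult subset_mean_const) simp
  also have "\<dots> = subset_mean X p (\<lambda>W. card (J W) / N - \<delta>)"
    by (simp add: J diff_divide_distrib algebra_simps)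
  also have "\<dots> \<le> subset_mean X p (\<lambda>W. hit_mean X q1 (J W) (fragment I A W))"
  proof (rule subset_mean_mono)
    fix W
    have sub: "J W \<subseteq> I" unfolding J_def by auto
    \<comment> \<open>A set inside a fragment lies inside the original member, so the bound is
      inherited with the same \<open>N\<close>.\<close>
    have "spread (J W) (fragment I A W) N \<kappa>"
      unfolding spread_def
    proof (intro allI impI)
      fix S :: "'a set" assume "finite S"
      have "card {i \<in> J W. S \<subseteq> fragment I A W i} \<le> card {i \<in> I. S \<subseteq> A i}"
        using I sub fragment_subset[of _ I A W] by (intro card_mono) auto
      then show "real (card {i \<in> J W. S \<subseteq> fragment I A W i}) \<le> N / \<kappa> ^ card S"
        using sp \<open>finite S\<close> unfolding spread_def by (meson of_nat_mono order_trans)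
    qed
    moreover have "\<forall>i\<in>J W. fragment I A W i \<subseteq> X \<and> card (fragment I A W i) \<le> m"
      using fragment_subset[of _ I A W] A unfolding J_def by fastforce
    ultimately show "card (J W) / N - \<delta> \<le> hit_mean X q1 (J W) (fragment I A W)"
      using hits q1 finite_subset[OF sub I] unfolding hits_def by blast
  qed (use p in auto)
  \<comment> \<open>If the second set \<open>T\<close> covers a fragment, then
    \<open>W \<union> T\<close> covers the member that produced it.\<close>
  also have "\<dots> \<le> subset_mean X p (\<lambda>W. subset_mean X q1 (\<lambda>T. of_bool (\<exists>i\<in>I. A i \<subseteq> W \<union> T)))"
    unfolding hit_mean_def
  proof (intro subset_mean_mono)
    fix W T
    show "of_bool (\<exists>i\<in>J W. fragment I A W i \<subseteq> T) \<le> (of_bool (\<exists>i\<in>I. A i \<subseteq> W \<union> T) :: real)"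
      using fragment_index(1)[of _ I A W] unfolding J_def fragment_def of_bool_def by auto
  qed (use p q q1 in auto)
  also have "\<dots> = hit_mean X q' I A"
    using subset_mean_two_rounds[OF X, of p q1 "\<lambda>W. of_bool (\<exists>i\<in>I. A i \<subseteq> W)"] q1(3)
    unfolding hit_mean_def by simp
  finally show "card I / N - (\<delta> + 2 ^ r / (p * \<kappa>) ^ Suc m) \<le> hit_mean X q' I A" .
qed

lemma hits_mono:
  assumes "hits TYPE('i) X N \<kappa> r q \<delta>" "r' \<le> r" "q \<le> q'" "\<delta> \<le> \<delta>'"
  shows "hits TYPE('i) X N \<kappa> r' q' \<delta>'"
  unfolding hits_def
proof (intro allI impI)
  fix I :: "'i set" and A p
  assume *: "finite I" "\<forall>i\<in>I. A i \<subseteq> X \<and> card (A i) \<le> r'" "spread I A N \<kappa>" "q' \<le> p" "p \<le> 1"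
  have "card I / N - \<delta> \<le> hit_mean X p I A"
    using assms(1)[unfolded hits_def, rule_format, of I A p] * assms(2,3) by force
  then show "card I / N - \<delta>' \<le> hit_mean X p I A"
    using assms(4) by simp
qed

text \<open>
  Rounds of density \<open>16 / \<kappa>\<close> halve the set size while it exceeds \<open>M\<close>; the errors decay
  geometrically. The last round, of density \<open>L / \<kappa>\<close>, removes what is left of size at most \<open>M\<close>.
\<close>

lemma hits_iterate:
  fixes N \<kappa> L :: real
  assumes X: "finite X" and N: "0 < N" and \<kappa>: "16 < \<kappa>" and L: "1 \<le> L" "L < \<kappa>" and M: "1 \<le> M"
  shows "hits TYPE('i) X N \<kappa> (2 ^ j * M) ((L + 16 * real j) / \<kappa>)
    (2 ^ M / L + 2 * (1 / 4) ^ M * (1 - (1 / 4) ^ j))"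
proof (induction j)
  case 0
  \<comment> \<open>Going from size \<open>M\<close> to size 0 in one round has an error with
    exponent \<open>Suc 0\<close>, that is \<open>2 ^ M / L\<close>.\<close>
  have "hits TYPE('i) X N \<kappa> M (L / \<kappa> + 0) (0 + 2 ^ M / (L / \<kappa> * \<kappa>) ^ Suc 0)"
    using hits_step[OF X N _ _ _ _ hits_0[OF X N], of "L / \<kappa>" \<kappa> M] L \<kappa> by simp
  then show ?case
    using \<kappa> by simp
next
  case (Suc j)
  let ?m = "2 ^ j * M"
  have \<kappa>0: "16 / \<kappa> * \<kappa> = 16" using \<kappa> by simp
  have "hits TYPE('i) X N \<kappa> (2 * ?m) (16 / \<kappa> + (L + 16 * real j) / \<kappa>)
    (2 ^ M / L + 2 * (1 / 4) ^ M * (1 - (1 / 4) ^ j) + 2 ^ (2 * ?m) / (16 / \<kappa> * \<kappa>) ^ Suc ?m)"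
    by (rule hits_step[OF X N _ _ _ _ Suc.IH]) (use \<kappa> L in simp_all)
  \<comment> \<open>The right-hand side is exactly the increment of
    \<open>2 * (1 / 4) ^ M * (1 - (1 / 4) ^ j)\<close> from \<open>j\<close> to
    \<open>j + 1\<close>.\<close>
  moreover have "2 ^ (2 * ?m) / (16 / \<kappa> * \<kappa>) ^ Suc ?m \<le> (2 * (1 / 4) ^ M * (3 / 4) * (1 / 4) ^ j :: real)"
  proof -
    have "2 ^ (2 * k) / 16 ^ Suc k = (1 / 16) * (1 / 4 :: real) ^ k" for k
    proof -
      have "(16 :: real) ^ k = 4 ^ k * 4 ^ k"
        by (simp flip: power_mult_distrib)
      moreover have "(2 :: real) ^ (2 * k) = 4 ^ k"
        unfolding power_mult by simp
      ultimately show ?thesis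
        by (simp only: power_Suc power_one_over) simp
    qed
    then have "2 ^ (2 * ?m) / (16 / \<kappa> * \<kappa>) ^ Suc ?m = (1 / 16) * (1 / 4 :: real) ^ ?m"
      unfolding \<kappa>0 .
    also have "\<dots> \<le> (1 / 4) ^ ?m"
      by simp
    also have "\<dots> \<le> (1 / 4) ^ (M + j)"
    proof (rule power_decreasing)
      have "M + j \<le> (j + 1) * M"
        using M by (cases M) auto
      also have "\<dots> \<le> ?m"
        using Suc_leI[OF less_exp[of j]] by (intro mult_right_mono) auto
      finally show "M + j \<le> ?m" .
    qed auto
    also have "\<dots> \<le> 2 * (1 / 4) ^ M * (3 / 4) * (1 / 4) ^ j"
      by (simp add: power_add)
    finally show ?thesis .
  qed
  ultimately show ?case
    using \<kappa> by (elim hits_mono) (simp_all add: field_simps)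
qed

text \<open>With \<open>L = ln n\<close>, about \<open>log 2 n\<close> halvings reach size
  \<open>n\<close>. Since \<open>j \<le> 3 * L\<close>, the density used is at most
  \<open>49 * L / \<kappa>\<close>, and \<open>49 * 36 = 1764\<close>. The cutoff \<open>M\<close>
  stays free, so that it can be fixed before \<open>n\<close> grows.\<close>

lemma hits_logarithmic:
  assumes X: "finite X" and N: "0 < N" and n: "n \<ge> 3" and M: "1 \<le> M"
    and q: "1764 * ln (real n) / (real n)\<^sup>2 \<le> q" "q < 1"
  shows "hits TYPE('i) X N ((real n)\<^sup>2 / 36) n q (2 ^ M / ln (real n) + 2 * (1 / 4) ^ M)"
proof -
  define L where "L = ln (real n)"
  define \<kappa> where "\<kappa> = (real n)\<^sup>2 / 36"
  define j where "j = nat \<lceil>log 2 (real n)\<rceil>"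
  have L: "1 \<le> L"
  proof -
    have "exp 1 \<le> real n" using exp_le n by linarith
    then show ?thesis unfolding L_def using n by (subst ln_ge_iff) auto
  qed
  have log0: "0 < log 2 (real n)" using n by simp
  have j: "1 \<le> j" "real j \<le> 3 * L" "n \<le> 2 ^ j"
  proof -
    show "1 \<le> j" unfolding j_def using log0 by linarith
    have "real j \<le> log 2 (real n) + 1"
      unfolding j_def using log0 by linarith
    also have "log 2 (real n) \<le> 2 * L"
    proof -
      have "1 / 2 \<le> ln (2::real)"
        using ln2_ge_two_thirds by simp
      then have "L * 1 \<le> L * (2 * ln 2)"
        using L by (intro mult_left_mono) auto
      then show ?thesis
        unfolding log_def L_def[symmetric] by (simp add: divide_le_eq)
    qed
    finally show "real j \<le> 3 * L" using L by simp
    have "log 2 (real n) \<le> real j"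
      unfolding j_def using log0 by linarith
    then have "real n \<le> 2 powr real j"
      using n by (simp add: log_le_iff)
    then show "n \<le> 2 ^ j"
      by (simp add: powr_realpow)
  qed
  have \<kappa>0: "0 < \<kappa>" unfolding \<kappa>_def using n by simp
  have "(L + 16 * real j) / \<kappa> \<le> 49 * L / \<kappa>"
    using j(2) \<kappa>0 by (intro divide_right_mono) auto
  also have "\<dots> \<le> q"
    using q(1) unfolding \<kappa>_def L_def by simp
  finally have dens: "(L + 16 * real j) / \<kappa> \<le> q" .
  then have "(L + 16 * real j) / \<kappa> < 1"
    using q(2) by linarith
  then have "L + 16 * real j < \<kappa>"
    using \<kappa>0 by (simp only: pos_divide_less_eq mult_1)
  then have "16 < \<kappa>" "L < \<kappa>"
    using L j(1) by linarith+
  from hits_iterate[OF X N this(1) L this(2) M, of j]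
  have "hits TYPE('i) X N \<kappa> n q (2 ^ M / L + 2 * (1 / 4) ^ M)"
  proof (rule hits_mono)
    show "n \<le> 2 ^ j * M" using j(3) M by (cases M) auto
    show "2 ^ M / L + 2 * (1 / 4) ^ M * (1 - (1 / 4) ^ j) \<le> 2 ^ M / L + 2 * (1 / 4) ^ M"
      by (simp add: algebra_simps)
  qed (rule dens)
  then show ?thesis
    unfolding L_def \<kappa>_def .
qed

subsection \<open>Colouring edges versus selecting pairs\<close>

text \<open>
  The property of a family of sets of (edge, colour) pairs that makes the coupling work: no member
  needs two colours of the same edge.
\<close>

definition single_coloured :: "('e \<times> 'c) set set \<Rightarrow> bool" where
  "single_coloured \<F> \<longleftrightarrow> (\<forall>W T. W \<in> \<F> \<longrightarrow> W \<subseteq> T \<longrightarrow> T \<in> \<F>) \<and>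
    (\<forall>W e T. W \<union> {e} \<times> T \<in> \<F> \<longrightarrow> W \<in> \<F> \<or> (\<exists>c\<in>T. insert (e, c) W \<in> \<F>))"

lemma single_coloured_superset: "single_coloured \<F> \<Longrightarrow> W \<in> \<F> \<Longrightarrow> W \<subseteq> T \<Longrightarrow> T \<in> \<F>"
  unfolding single_coloured_def by blast

lemma single_coloured_fibre:
  "single_coloured \<F> \<Longrightarrow> W \<union> {e} \<times> T \<in> \<F> \<Longrightarrow> W \<in> \<F> \<or> (\<exists>c\<in>T. insert (e, c) W \<in> \<F>)"
  unfolding single_coloured_def by blast

text \<open>A member that is injective on edges uses at most one pair over \<open>e\<close>, so at
  most one pair from \<open>{e} \<times> T\<close> is needed to complete it.\<close>

lemma single_coloured_upset:
  assumes "\<And>i. i \<in> I \<Longrightarrow> inj_on fst (A i)"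
  shows "single_coloured {W. \<exists>i\<in>I. A i \<subseteq> W}"
  unfolding single_coloured_def
proof (intro conjI allI impI)
  fix W e T assume "W \<union> {e} \<times> T \<in> {W. \<exists>i\<in>I. A i \<subseteq> W}"
  then obtain i where i: "i \<in> I" "A i \<subseteq> W \<union> {e} \<times> T" by auto
  show "W \<in> {W. \<exists>i\<in>I. A i \<subseteq> W} \<or> (\<exists>c\<in>T. insert (e, c) W \<in> {W. \<exists>i\<in>I. A i \<subseteq> W})"
  proof (cases "A i \<subseteq> W")
    case False
    then obtain c where c: "c \<in> T" "(e, c) \<in> A i"
      using i(2) by auto
    have "A i \<subseteq> insert (e, c) W"
    proof
      fix x assume x: "x \<in> A i"
      show "x \<in> insert (e, c) W"
      proof (cases "fst x = e")
        case True
        then show ?thesis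
          using inj_onD[OF assms[OF i(1)], of x "(e, c)"] x c(2) by auto
      qed (use x i(2) in auto)
    qed
    then show ?thesis using c(1) i(1) by blast
  qed (use i(1) in blast)
qed blast

text \<open>This keeps the class closed under fixing the colour of one edge, as the induction over
  edges requires.\<close>

lemma single_coloured_insert:
  assumes "single_coloured \<F>"
  shows "single_coloured {W. insert x W \<in> \<F>}"
  unfolding single_coloured_def
proof (intro conjI allI impI)
  fix W T assume "W \<in> {W. insert x W \<in> \<F>}" "W \<subseteq> T"
  then show "T \<in> {W. insert x W \<in> \<F>}"
    using single_coloured_superset[OF assms, of "insert x W" "insert x T"] by auto
next
  fix W e T assume "W \<union> {e} \<times> T \<in> {W. insert x W \<in> \<F>}"
  then have "insert x W \<union> {e} \<times> T \<in> \<F>" by simp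
  then have "insert x W \<in> \<F> \<or> (\<exists>c\<in>T. insert (e, c) (insert x W) \<in> \<F>)"
    by (rule single_coloured_fibre[OF assms])
  then show "W \<in> {W. insert x W \<in> \<F>} \<or> (\<exists>c\<in>T. insert (e, c) W \<in> {W. insert x W \<in> \<F>})"
    by (simp add: insert_commute)
qed

text \<open>The right-hand side describes \<open>e\<close> absent with weight
  \<open>1 - card C * q\<close> and otherwise in one uniform colour. If \<open>W\<close> is already
  in the family, both sides are 1. Otherwise the indicator is at most the number of selected pairs
  that complete a member on their own.\<close>

lemma subset_mean_fibre_le:
  fixes q :: real
  assumes F: "single_coloured \<F>" and C: "finite C" and q: "0 \<le> q" "q \<le> 1"
  shows "subset_mean ({e} \<times> C) q (\<lambda>T. of_bool (W \<union> T \<in> \<F>)) \<le>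
    (1 - card C * q) * of_bool (W \<in> \<F>) + q * (\<Sum>c\<in>C. of_bool (insert (e, c) W \<in> \<F>))"
proof (cases "W \<in> \<F>")
  case True
  then have "W \<union> T \<in> \<F>" "insert (e, c) W \<in> \<F>" for T c
    by (auto intro: single_coloured_superset[OF F True])
  then show ?thesis
    using C True by simp
next
  case False
  have "subset_mean ({e} \<times> C) q (\<lambda>T. of_bool (W \<union> T \<in> \<F>)) \<le>
      subset_mean ({e} \<times> C) q (\<lambda>T. \<Sum>y\<in>T. of_bool (insert y W \<in> \<F>))"
  proof (rule subset_mean_mono)
    fix T assume T: "T \<subseteq> {e} \<times> C"
    then have fin: "finite T"
      using C by (auto intro: finite_subset)
    show "of_bool (W \<union> T \<in> \<F>) \<le> (\<Sum>y\<in>T. of_bool (insert y W \<in> \<F>) :: real)"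
    proof (cases "W \<union> T \<in> \<F>")
      case True
      have eq: "T = {e} \<times> {c. (e, c) \<in> T}" using T by auto
      obtain c where c: "(e, c) \<in> T" "insert (e, c) W \<in> \<F>"
        using single_coloured_fibre[OF F, of W e "{c. (e, c) \<in> T}"] True False eq by auto
      have "of_bool (W \<union> T \<in> \<F>) \<le> (of_bool (insert (e, c) W \<in> \<F>) :: real)"
        using c by simp
      also have "\<dots> \<le> (\<Sum>y\<in>T. of_bool (insert y W \<in> \<F>))"
        using fin c by (intro member_le_sum) auto
      finally show ?thesis .
    qed (auto intro: sum_nonneg)
  qed (use q in auto)
  also have "\<dots> = q * (\<Sum>y\<in>{e} \<times> C. of_bool (insert y W \<in> \<F>))"
    using C by (intro subset_mean_sum_elements) auto
  also have "(\<Sum>y\<in>{e} \<times> C. of_bool (insert y W \<in> \<F>)) = (\<Sum>c\<in>C. of_bool (insert (e, c) W \<in> \<F>) :: real)"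
    by (rule sum.reindex_cong[of "Pair e"]) (auto simp: inj_on_def)
  finally show ?thesis
    using False by simp
qed

text \<open>The coloured random graph over an arbitrary edge set, so that induction can add one edge
  at a time.\<close>

definition random_colouring ::
    "'e set \<Rightarrow> 'c set \<Rightarrow> 'c \<Rightarrow> real \<Rightarrow> ('e set \<times> ('e \<Rightarrow> 'c)) pmf" where
  "random_colouring E C d p =
     bind_pmf (map_pmf (\<lambda>present. {e \<in> E. present e}) (Pi_pmf E False (\<lambda>_. bernoulli_pmf p)))
       (\<lambda>G. map_pmf (\<lambda>col. (G, col)) (Pi_pmf G d (\<lambda>_. pmf_of_set C)))"

definition coloured_pairs :: "'e set \<times> ('e \<Rightarrow> 'c) \<Rightarrow> ('e \<times> 'c) set" where
  "coloured_pairs G = (\<lambda>e. (e, snd G e)) ` fst G"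

lemma random_colouring_empty: "random_colouring {} C d p = return_pmf ({}, \<lambda>_. d)"
  by (simp add: random_colouring_def bind_return_pmf)

text \<open>The presence and colour of \<open>e\<close> are independent of everything else, so they
  may be drawn first. Swapping the two independent draws is the only rearrangement of
  substance.\<close>

lemma random_colouring_insert:
  assumes "finite E" "e \<notin> E"
  shows "random_colouring (insert e E) C d p =
    bind_pmf (bernoulli_pmf p) (\<lambda>b. if b
      then bind_pmf (pmf_of_set C) (\<lambda>c. map_pmf (\<lambda>(G, col). (insert e G, col(e := c))) (random_colouring E C d p))
      else random_colouring E C d p)"
proof -
  let ?P = "Pi_pmf E False (\<lambda>_. bernoulli_pmf p)"
  let ?Q = "\<lambda>G. Pi_pmf G d (\<lambda>_. pmf_of_set C)"
  have set: "{x \<in> insert e E. (f(e := b)) x} = (if b then insert e {x \<in> E. f x} else {x \<in> E. f x})" for f b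
    using assms(2) by auto
  have "random_colouring (insert e E) C d p =
      bind_pmf (bernoulli_pmf p) (\<lambda>b. bind_pmf ?P (\<lambda>f.
        map_pmf (Pair (if b then insert e {x \<in> E. f x} else {x \<in> E. f x}))
          (?Q (if b then insert e {x \<in> E. f x} else {x \<in> E. f x}))))"
    unfolding random_colouring_def Pi_pmf_insert'[OF assms] map_pmf_def bind_assoc_pmf bind_return_pmf set ..
  also have "\<dots> = bind_pmf (bernoulli_pmf p) (\<lambda>b. if b
      then bind_pmf (pmf_of_set C) (\<lambda>c. map_pmf (\<lambda>(G, col). (insert e G, col(e := c))) (random_colouring E C d p))
      else random_colouring E C d p)"
  proof (intro bind_pmf_cong refl)
    fix b
    have "bind_pmf ?P (\<lambda>f. map_pmf (Pair (insert e {x \<in> E. f x})) (?Q (insert e {x \<in> E. f x}))) =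
        bind_pmf ?P (\<lambda>f. bind_pmf (pmf_of_set C) (\<lambda>c.
          map_pmf (\<lambda>col. (insert e {x \<in> E. f x}, col(e := c))) (?Q {x \<in> E. f x})))"
      using assms by (simp add: Pi_pmf_insert' map_pmf_def bind_assoc_pmf bind_return_pmf)
    also have "\<dots> = bind_pmf (pmf_of_set C) (\<lambda>c.
        map_pmf (\<lambda>(G, col). (insert e G, col(e := c))) (random_colouring E C d p))"
      by (subst bind_commute_pmf)
        (simp add: random_colouring_def map_pmf_def bind_assoc_pmf bind_return_pmf)
    finally show "bind_pmf ?P (\<lambda>f. map_pmf (Pair (if b then insert e {x \<in> E. f x} else {x \<in> E. f x}))
          (?Q (if b then insert e {x \<in> E. f x} else {x \<in> E. f x}))) =
      (if b
        then bind_pmf (pmf_of_set C) (\<lambda>c. map_pmf (\<lambda>(G, col). (insert e G, col(e := c))) (random_colouring E C d p))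
        else random_colouring E C d p)"
      by (cases b) (simp_all add: random_colouring_def map_pmf_def bind_assoc_pmf bind_return_pmf)
  qed
  finally show ?thesis .
qed

lemma set_random_colouring:
  assumes "finite E" "x \<in> set_pmf (random_colouring E C d p)"
  shows "fst x \<subseteq> E"
  using assms unfolding random_colouring_def by auto

lemma prob_bind_pmf:
  "measure_pmf.prob (bind_pmf M f) S = measure_pmf.expectation M (\<lambda>x. measure_pmf.prob (f x) S)"
proof -
  have "ennreal (measure_pmf.prob (bind_pmf M f) S) = (\<integral>\<^sup>+x. ennreal (measure_pmf.prob (f x) S) \<partial>M)"
    by (simp add: measure_pmf.emeasure_eq_measure[symmetric])
  also have "\<dots> = ennreal (measure_pmf.expectation M (\<lambda>x. measure_pmf.prob (f x) S))"
    by (intro nn_integral_eq_integral measure_pmf.integrable_const_bound[of _ 1]) auto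
  finally show ?thesis
    by (simp add: integral_nonneg_AE)
qed

text \<open>
  Edge by edge, an edge present with probability \<open>p\<close> in one uniform colour out of \<open>c\<close> is at least
  as useful as an edge carrying each colour independently with probability \<open>p / c\<close>, by the union
  bound over the colours that complete a member of \<open>\<F>\<close>.
\<close>

lemma subset_mean_le_random_colouring:
  fixes C :: "'c set" and E :: "'e set" and p :: real
  assumes E: "finite E" and C: "finite C" "C \<noteq> {}" and p: "0 \<le> p" "p \<le> 1"
    and F: "single_coloured \<F>"
  shows "subset_mean (E \<times> C) (p / card C) (\<lambda>W. of_bool (W \<in> \<F>)) \<le>
    measure_pmf.prob (random_colouring E C d p) {G. coloured_pairs G \<in> \<F>}"
  using E F
proof (induction E arbitrary: \<F> rule: finite_induct)
  case empty
  then show ?case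
    by (simp add: random_colouring_empty coloured_pairs_def measure_return indicator_def)
next
  case (insert e E)
  let ?q = "p / card C"
  let ?prob = "\<lambda>\<F>. measure_pmf.prob (random_colouring E C d p) {G. coloured_pairs G \<in> \<F>}"
  have cC: "card C > 0" using C by (simp add: card_gt_0_iff)
  have q: "0 \<le> ?q" "?q \<le> 1" "card C * ?q = p"
    using p cC by (auto simp: divide_le_eq)
  \<comment> \<open>Overwriting the colour at \<open>e\<close> does not affect the edges of
    \<open>G\<close>, because \<open>e\<close> lies outside \<open>E\<close>.\<close>
  have pairs: "coloured_pairs (insert e G, col(e := c)) = insert (e, c) (coloured_pairs (G, col))"
    if "G \<subseteq> E" for G col and c :: 'c
  proof -
    have "(\<lambda>x. (x, (col(e := c)) x)) ` G = (\<lambda>x. (x, col x)) ` G"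
      using that insert.hyps(2) by (intro image_cong) auto
    then show ?thesis
      unfolding coloured_pairs_def by simp
  qed
  have "subset_mean (insert e E \<times> C) ?q (\<lambda>W. of_bool (W \<in> \<F>)) =
      subset_mean (E \<times> C) ?q (\<lambda>W. subset_mean ({e} \<times> C) ?q (\<lambda>T. of_bool (W \<union> T \<in> \<F>)))"
  proof -
    have "insert e E \<times> C = E \<times> C \<union> {e} \<times> C" by auto
    then show ?thesis
      using insert.hyps C by (simp only:) (intro subset_mean_Un, auto)
  qed
  also have "\<dots> \<le> subset_mean (E \<times> C) ?q (\<lambda>W. (1 - p) * of_bool (W \<in> \<F>) +
      ?q * (\<Sum>c\<in>C. of_bool (insert (e, c) W \<in> \<F>)))"
    using q subset_mean_fibre_le[OF insert.prems C(1) q(1,2)] by (intro subset_mean_mono) auto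
  also have "\<dots> = (1 - p) * subset_mean (E \<times> C) ?q (\<lambda>W. of_bool (W \<in> \<F>)) +
      ?q * (\<Sum>c\<in>C. subset_mean (E \<times> C) ?q (\<lambda>W. of_bool (W \<in> {W. insert (e, c) W \<in> \<F>})))"
    by (simp only: subset_mean_add subset_mean_cmult subset_mean_sum mem_Collect_eq)
  also have "\<dots> \<le> (1 - p) * ?prob \<F> + ?q * (\<Sum>c\<in>C. ?prob {W. insert (e, c) W \<in> \<F>})"
    using p q
    by (intro add_mono mult_left_mono sum_mono insert.IH insert.prems single_coloured_insert) simp_all
  also have "\<dots> = measure_pmf.prob (random_colouring (insert e E) C d p) {G. coloured_pairs G \<in> \<F>}"
  proof -
    have "measure_pmf.prob (map_pmf (\<lambda>(G, col). (insert e G, col(e := c))) (random_colouring E C d p))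
        {G. coloured_pairs G \<in> \<F>} = ?prob {W. insert (e, c) W \<in> \<F>}" for c
      unfolding measure_map_pmf
    \<comment> \<open>The identity \<open>pairs\<close> requires the graph to lie inside
      \<open>E\<close>, which holds on the support; hence equality almost surely.\<close>
    proof (rule measure_pmf.finite_measure_eq_AE)
      show "AE x in random_colouring E C d p.
          (x \<in> (\<lambda>(G, col). (insert e G, col(e := c))) -` {G. coloured_pairs G \<in> \<F>}) =
          (x \<in> {G. coloured_pairs G \<in> {W. insert (e, c) W \<in> \<F>}})"
        using set_random_colouring[OF insert.hyps(1), of _ C d p] pairs
        by (fastforce simp: AE_measure_pmf_iff)
    qed auto
    then show ?thesis
      using p C insert.hyps
      by (simp add: random_colouring_insert prob_bind_pmf integral_pmf_of_set if_distrib)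
  qed
  finally show ?case .
qed

subsection \<open>Counting Hamilton cycles\<close>

lemma filter_eq_imp_eq:
  assumes "length xs = length ys" "filter P xs = filter P ys"
    and "\<And>i. i < length xs \<Longrightarrow> P (xs ! i) = P (ys ! i)"
    and "\<And>i. i < length xs \<Longrightarrow> \<not> P (xs ! i) \<Longrightarrow> xs ! i = ys ! i"
  shows "xs = ys"
  using assms
proof (induction xs ys rule: list_induct2)
  case (Cons x xs y ys)
  have 0: "P x = P y" "\<not> P x \<Longrightarrow> x = y"
    using Cons.prems(2)[of 0] Cons.prems(3)[of 0] by simp_all
  have "xs = ys"
  proof (rule Cons.IH)
    show "filter P xs = filter P ys"
      using Cons.prems(1) 0 by (auto split: if_splits)
    show "P (xs ! i) = P (ys ! i)" if "i < length xs" for i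
      using Cons.prems(2)[of "Suc i"] that by simp
    show "xs ! i = ys ! i" if "i < length xs" "\<not> P (xs ! i)" for i
      using Cons.prems(3)[of "Suc i"] that by simp
  qed
  moreover have "x = y"
    using Cons.prems(1) 0 by (auto split: if_splits)
  ultimately show ?case by simp
qed simp

text \<open>Deleting the prescribed values leaves a permutation of the other elements, and the
  deletion can be undone since the prescribed positions are known. If some permutation qualifies,
  \<open>g\<close> is injective on \<open>J\<close>, so exactly \<open>card J\<close> values are
  deleted.\<close>

lemma card_permutations_prescribed:
  assumes V: "finite V" and J: "finite J"
  shows "card {xs \<in> permutations_of_set V. \<forall>i\<in>J. i < card V \<and> xs ! i = g i} \<le> fact (card V - card J)"
proof (cases "{xs \<in> permutations_of_set V. \<forall>i\<in>J. i < card V \<and> xs ! i = g i} = {}")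
  case False
  let ?S = "{xs \<in> permutations_of_set V. \<forall>i\<in>J. i < card V \<and> xs ! i = g i}"
  have S: "distinct xs" "set xs = V" "length xs = card V" "\<And>i. i \<in> J \<Longrightarrow> i < card V \<and> xs ! i = g i"
    if "xs \<in> ?S" for xs
    using that permutations_of_setD length_finite_permutations_of_set by auto
  obtain zs where zs: "zs \<in> ?S" using False by blast
  have "inj_on g J"
    using S[OF zs] by (intro inj_onI) (metis nth_eq_iff_index_eq)
  then have cardg: "card (g ` J) = card J" by (rule card_image)
  have gV: "g ` J \<subseteq> V"
    using S[OF zs] by (metis image_subsetI nth_mem)
  have mem: "xs ! i \<in> g ` J \<longleftrightarrow> i \<in> J" if xs: "xs \<in> ?S" and i: "i < length xs" for xs i
  proof
    assume "xs ! i \<in> g ` J"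
    then obtain j where "j \<in> J" "xs ! i = g j" by blast
    with S[OF xs] i have "i = j"
      by (metis nth_eq_iff_index_eq)
    then show "i \<in> J" using \<open>j \<in> J\<close> by simp
  qed (use S(4)[OF xs] in auto)
  have "card ?S \<le> card (permutations_of_set (V - g ` J))"
  proof (rule card_inj_on_le)
    show "inj_on (filter (\<lambda>x. x \<notin> g ` J)) ?S"
    proof (rule inj_onI)
      fix xs ys assume xs: "xs \<in> ?S" and ys: "ys \<in> ?S"
        and eq: "filter (\<lambda>x. x \<notin> g ` J) xs = filter (\<lambda>x. x \<notin> g ` J) ys"
      show "xs = ys"
      proof (rule filter_eq_imp_eq[OF _ eq])
        show len: "length xs = length ys"
          using S(3)[OF xs] S(3)[OF ys] by simp
        show "(xs ! i \<notin> g ` J) = (ys ! i \<notin> g ` J)" if "i < length xs" for i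
          using mem[OF xs that] mem[OF ys] that len by simp
        show "xs ! i = ys ! i" if "i < length xs" "\<not> xs ! i \<notin> g ` J" for i
          using mem[OF xs that(1)] that(2) S(4)[OF xs] S(4)[OF ys] by simp
      qed
    qed
    show "filter (\<lambda>x. x \<notin> g ` J) ` ?S \<subseteq> permutations_of_set (V - g ` J)"
      using S(1,2) by (auto intro!: permutations_of_setI)
  qed (use V in simp)
  also have "\<dots> = fact (card V - card J)"
    using V gV cardg J by (simp add: card_Diff_subset)
  finally show ?thesis .
qed (simp only: card.empty zero_le)

text \<open>Read from left to right: after an element of \<open>P\<close> the next entry is forced
  by \<open>d\<close>; after any other element it is outside \<open>R\<close>, hence the next entry
  of the filtered list. Only the first entry needs separate information.\<close>

lemma succ_filter_eq_imp_eq: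
  assumes "length xs = length ys" "xs \<noteq> []" "hd xs = hd ys"
    and "filter (\<lambda>x. x \<notin> R) xs = filter (\<lambda>x. x \<notin> R) ys"
    and "\<And>i. Suc i < length xs \<Longrightarrow> if xs ! i \<in> P then xs ! Suc i = d (xs ! i) else xs ! Suc i \<notin> R"
    and "\<And>i. Suc i < length ys \<Longrightarrow> if ys ! i \<in> P then ys ! Suc i = d (ys ! i) else ys ! Suc i \<notin> R"
  shows "xs = ys"
  using assms
proof (induction xs ys rule: list_induct2)
  case (Cons x xs y ys)
  have [simp]: "y = x" using Cons.prems by simp
  show ?case
  proof (cases "xs = []")
    case True
    then show ?thesis using Cons.hyps by simp
  next
    case False
    then obtain u us v vs where uv: "xs = u # us" "ys = v # vs"
      using Cons.hyps by (metis length_0_conv neq_Nil_conv)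
    have filter: "filter (\<lambda>x. x \<notin> R) xs = filter (\<lambda>x. x \<notin> R) ys"
      using Cons.prems(3) by (auto split: if_splits)
    have "hd xs = hd ys"
      using Cons.prems(4)[of 0] Cons.prems(5)[of 0] filter uv by (auto split: if_splits)
    moreover have "if xs ! i \<in> P then xs ! Suc i = d (xs ! i) else xs ! Suc i \<notin> R"
      if "Suc i < length xs" for i
      using Cons.prems(4)[of "Suc i"] that by (simp split: if_splits)
    moreover have "if ys ! i \<in> P then ys ! Suc i = d (ys ! i) else ys ! Suc i \<notin> R"
      if "Suc i < length ys" for i
      using Cons.prems(5)[of "Suc i"] that by (simp split: if_splits)
    ultimately have "xs = ys"
      using Cons.IH[OF False] filter by blast
    then show ?thesis by simp
  qed
qed simp

section \<open>Vertex orders whose cycle contains given edges\<close>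

abbreviation cycle_edge :: "'a list \<Rightarrow> nat \<Rightarrow> 'a set" where
  "cycle_edge xs i \<equiv> {xs ! i, xs ! (Suc i mod length xs)}"

text \<open>Two positions with the same edge would follow each other cyclically in both directions,
  which needs length 2.\<close>

lemma inj_on_cycle_edge:
  assumes "distinct xs" "length xs \<ge> 3"
  shows "inj_on (cycle_edge xs) {..<length xs}"
proof (rule inj_onI)
  fix i j assume i: "i \<in> {..<length xs}" and j: "j \<in> {..<length xs}"
    and eq: "cycle_edge xs i = cycle_edge xs j"
  let ?n = "length xs"
  have lt: "Suc k mod ?n < ?n" for k
    using assms(2) by (intro mod_less_divisor) linarith
  have "i = j \<or> (i = Suc j mod ?n \<and> Suc i mod ?n = j)"
    using eq assms(1) i j lt by (auto simp: doubleton_eq_iff nth_eq_iff_index_eq)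
  then show "i = j"
    using assms(2) i j by (auto simp: mod_Suc split: if_splits)
qed

text \<open>
  The edges of \<open>F\<close> are oriented by their heads \<open>h\<close>. Vertices that are not heads occur in \<open>xs\<close> in an
  arbitrary order; each head follows its tail, except for a head in the first position.
\<close>

lemma card_oriented_cycles_le:
  assumes V: "finite V" "card V \<ge> 3" and F: "finite F"
  shows "card {xs \<in> permutations_of_set V. \<forall>e\<in>F. \<exists>i<card V. e = cycle_edge xs i \<and>
    h e = xs ! (Suc i mod card V)} \<le> (card F + 1) * fact (card V - card F)"
proof (cases "{xs \<in> permutations_of_set V. \<forall>e\<in>F. \<exists>i<card V. e = cycle_edge xs i \<and>
    h e = xs ! (Suc i mod card V)} = {}")
  case False
  let ?S = "{xs \<in> permutations_of_set V. \<forall>e\<in>F. \<exists>i<card V. e = cycle_edge xs i \<and>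
    h e = xs ! (Suc i mod card V)}"
  let ?n = "card V"
  \<comment> \<open>\<open>R\<close> collects the heads, \<open>P\<close> the tails, and
    \<open>d\<close> sends a tail to the head of its edge.\<close>
  define R where "R = h ` F"
  define P where "P = {x. \<exists>e\<in>F. x \<in> e \<and> h e \<noteq> x}"
  define d where "d x = h (SOME e. e \<in> F \<and> x \<in> e \<and> h e \<noteq> x)" for x
  have S: "distinct xs" "set xs = V" "length xs = ?n"
      "\<And>e. e \<in> F \<Longrightarrow> \<exists>i<?n. e = cycle_edge xs i \<and> h e = xs ! (Suc i mod ?n)"
    if "xs \<in> ?S" for xs
    using that permutations_of_setD length_finite_permutations_of_set by auto
  have lt: "Suc k mod ?n < ?n" for k
    using V(2) by (intro mod_less_divisor) linarith
  have inj: "inj_on h F"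
  proof (rule inj_onI)
    fix e e' assume e: "e \<in> F" and e': "e' \<in> F" and eq: "h e = h e'"
    obtain xs where xs: "xs \<in> ?S" using False by blast
    obtain i j where ij: "i < ?n" "e = cycle_edge xs i" "h e = xs ! (Suc i mod ?n)"
        "j < ?n" "e' = cycle_edge xs j" "h e' = xs ! (Suc j mod ?n)"
      using S(4)[OF xs e] S(4)[OF xs e'] by blast
    have "Suc i mod ?n = Suc j mod ?n"
      using S(1,3)[OF xs] ij eq lt by (simp add: nth_eq_iff_index_eq)
    then have "i = j"
      using ij(1,4) by (simp add: mod_Suc split: if_splits)
    with ij(2,5) show "e = e'" by simp
  qed
  have RV: "R \<subseteq> V"
  proof
    fix x assume "x \<in> R"
    obtain xs where xs: "xs \<in> ?S" using False by blast
    obtain i where i: "i < ?n" "x = xs ! (Suc i mod ?n)"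
      using S(4)[OF xs] \<open>x \<in> R\<close> unfolding R_def by blast
    have "Suc i mod ?n < length xs"
      using S(3)[OF xs] lt by simp
    then show "x \<in> V"
      using nth_mem i S(2)[OF xs] by blast
  qed
  have succ: "if xs ! i \<in> P then xs ! Suc i = d (xs ! i) else xs ! Suc i \<notin> R"
    if xs: "xs \<in> ?S" and i: "Suc i < length xs" for xs i
  proof -
    have *: "h e = xs ! Suc i" if e: "e \<in> F" "xs ! i \<in> e" "h e \<noteq> xs ! i" for e
    proof -
      obtain j where j: "j < ?n" "e = cycle_edge xs j" "h e = xs ! (Suc j mod ?n)"
        using S(4)[OF xs e(1)] by blast
      then have "xs ! i = xs ! j"
        using e S(3)[OF xs] by auto
      then have "i = j"
        using S(1,3)[OF xs] i j by (simp add: nth_eq_iff_index_eq)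
      then show ?thesis
        using j i S(3)[OF xs] by simp
    qed
    show ?thesis
    proof (cases "xs ! i \<in> P")
      case True
      then have "\<exists>e. e \<in> F \<and> xs ! i \<in> e \<and> h e \<noteq> xs ! i"
        unfolding P_def by auto
      from someI_ex[OF this] have "d (xs ! i) = xs ! Suc i"
        unfolding d_def using * by blast
      then show ?thesis using True by simp
    next
      case notP: False
      have "xs ! Suc i \<notin> R"
      proof
        assume "xs ! Suc i \<in> R"
        then obtain e where e: "e \<in> F" "h e = xs ! Suc i"
          unfolding R_def by auto
        obtain j where j: "j < ?n" "e = cycle_edge xs j" "h e = xs ! (Suc j mod ?n)"
          using S(4)[OF xs e(1)] by blast
        then have "Suc j mod ?n = Suc i"
          using e(2) S(1,3)[OF xs] i lt by (simp add: nth_eq_iff_index_eq)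
        then have "i = j"
          using j(1) by (simp add: mod_Suc split: if_splits)
        then have "xs ! i \<in> e" "h e \<noteq> xs ! i"
          using j e S(1)[OF xs] i by (auto simp: nth_eq_iff_index_eq)
        then show False
          using notP e unfolding P_def by blast
      qed
      then show ?thesis using notP by simp
    qed
  qed
  \<comment> \<open>A head stands first only when its tail stands last, so no preceding entry forces
    it. Recording it, or \<open>None\<close>, gives the factor \<open>card F + 1\<close>.\<close>
  define \<phi> where "\<phi> = (\<lambda>xs. (if hd xs \<in> R then Some (hd xs) else None, filter (\<lambda>x. x \<notin> R) xs))"
  have "card ?S \<le> card (insert None (Some ` R) \<times> permutations_of_set (V - R))"
  proof (rule card_inj_on_le)
    show "inj_on \<phi> ?S"
    proof (rule inj_onI)
      fix xs ys assume xs: "xs \<in> ?S" and ys: "ys \<in> ?S" and eq: "\<phi> xs = \<phi> ys"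
      have len: "length xs = length ys" "xs \<noteq> []" "ys \<noteq> []"
        using S(3)[OF xs] S(3)[OF ys] V(2) by auto
      have filter: "filter (\<lambda>x. x \<notin> R) xs = filter (\<lambda>x. x \<notin> R) ys"
        using eq unfolding \<phi>_def by simp
      have "hd xs = hd ys"
      proof (cases "hd xs \<in> R")
        case False
        then have "hd ys \<notin> R" using eq unfolding \<phi>_def by (auto split: if_splits)
        with False filter len(2,3) show ?thesis
          by (cases xs; cases ys) auto
      qed (use eq in \<open>auto simp: \<phi>_def split: if_splits\<close>)
      then show "xs = ys"
        using succ_filter_eq_imp_eq[OF len(1,2) _ filter succ[OF xs] succ[OF ys]] by blast
    qed
    show "\<phi> ` ?S \<subseteq> insert None (Some ` R) \<times> permutations_of_set (V - R)"
      using S(1,2) unfolding \<phi>_def by (auto intro!: permutations_of_setI)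
    show "finite (insert None (Some ` R) \<times> permutations_of_set (V - R))"
      using F unfolding R_def by simp
  qed
  also have "\<dots> = (card F + 1) * fact (card V - card F)"
  proof -
    have R: "finite R" "card R = card F"
      using F inj unfolding R_def by (auto simp: card_image)
    have "card (insert None (Some ` R)) = card F + 1"
      using R by (subst card_insert_disjoint) (auto simp: card_image)
    moreover have "card (V - R) = card V - card F"
      using R RV by (simp add: card_Diff_subset)
    ultimately show ?thesis
      using V by (simp add: card_cartesian_product)
  qed
  finally show ?thesis .
qed (simp only: card.empty zero_le)

text \<open>There are \<open>2 ^ card F\<close> ways to choose a head for each edge, and
  \<open>card F + 1 \<le> 2 ^ card F\<close> absorbs the other factor.\<close>

lemma card_cycles_containing_le:
  assumes V: "finite V" "card V \<ge> 3" and F: "finite F"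
  shows "card {xs \<in> permutations_of_set V. F \<subseteq> cycle_edge xs ` {..<card V}} \<le> 4 ^ card F * fact (card V - card F)"
proof (cases "{xs \<in> permutations_of_set V. F \<subseteq> cycle_edge xs ` {..<card V}} = {}")
  case False
  let ?S = "{xs \<in> permutations_of_set V. F \<subseteq> cycle_edge xs ` {..<card V}}"
  let ?T = "\<lambda>h. {xs \<in> permutations_of_set V. \<forall>e\<in>F. \<exists>i<card V. e = cycle_edge xs i \<and>
    h e = xs ! (Suc i mod card V)}"
  have len: "length xs = card V" "distinct xs" if "xs \<in> ?S" for xs
    using that permutations_of_setD length_finite_permutations_of_set by auto
  have cardF: "card e = 2" if e: "e \<in> F" for e
  proof -
    obtain xs where xs: "xs \<in> ?S" using False by blast
    then obtain i where i: "i < card V" "e = cycle_edge xs i"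
      using e by auto
    have "i \<noteq> Suc i mod card V"
      using V(2) i(1) by (auto simp: mod_Suc)
    moreover have "Suc i mod card V < card V"
      using V(2) by (intro mod_less_divisor) linarith
    ultimately have "xs ! i \<noteq> xs ! (Suc i mod length xs)"
      using len[OF xs] i(1) by (simp add: nth_eq_iff_index_eq)
    then show ?thesis using i(2) by simp
  qed
  have finPi: "finite (PiE F (\<lambda>e. e))" 
    using F cardF by (intro finite_PiE) (auto intro: card_ge_0_finite)
  have cardPi: "card (PiE F (\<lambda>e. e)) = 2 ^ card F"
    using F cardF by (simp add: card_PiE)
  have "?S \<subseteq> (\<Union>h\<in>PiE F (\<lambda>e. e). ?T h)"
  proof
    fix xs assume xs: "xs \<in> ?S"
    then have "\<forall>e\<in>F. \<exists>i. i < card V \<and> e = cycle_edge xs i"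
      by auto
    then obtain pos where pos: "\<And>e. e \<in> F \<Longrightarrow> pos e < card V \<and> e = cycle_edge xs (pos e)"
      by metis
    define h where "h = restrict (\<lambda>e. xs ! (Suc (pos e) mod card V)) F"
    have "h \<in> PiE F (\<lambda>e. e)"
      unfolding h_def using pos len(1)[OF xs] by auto
    moreover have "xs \<in> ?T h"
      unfolding h_def using xs pos by auto
    ultimately show "xs \<in> (\<Union>h\<in>PiE F (\<lambda>e. e). ?T h)" by blast
  qed
  then have "card ?S \<le> card (\<Union>h\<in>PiE F (\<lambda>e. e). ?T h)"
    using finPi by (intro card_mono) auto
  also have "\<dots> \<le> (\<Sum>h\<in>PiE F (\<lambda>e. e). card (?T h))"
    using finPi by (rule card_UN_le)
  also have "\<dots> \<le> (\<Sum>h\<in>PiE F (\<lambda>e. e). (card F + 1) * fact (card V - card F))"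
    using card_oriented_cycles_le[OF V F] by (intro sum_mono)
  also have "\<dots> = 2 ^ card F * ((card F + 1) * fact (card V - card F))"
    using cardPi by simp
  also have "\<dots> \<le> 2 ^ card F * (2 ^ card F * fact (card V - card F))"
    using Suc_leI[OF less_exp[of "card F"]] by (intro mult_left_mono mult_right_mono) auto
  also have "\<dots> = 4 ^ card F * fact (card V - card F)"
    by (simp flip: power_mult_distrib mult.assoc)
  finally show ?thesis .
qed (simp only: card.empty zero_le)

text \<open>One term of the exponential series gives \<open>s ^ s \<le> 3 ^ s * fact s\<close>; this
  is combined with \<open>(n / s) ^ s \<le> n choose s\<close>.\<close>

lemma fact_diff_le:
  assumes "s \<le> n" "0 < n"
  shows "fact (n - s) \<le> fact n * (3 / real n) ^ s"
proof -
  have "real s ^ s / fact s \<le> exp (real s)"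
  proof -
    have "(\<Sum>k\<in>{s}. real s ^ k /\<^sub>R fact k) \<le> (\<Sum>k. real s ^ k /\<^sub>R fact k)"
      using exp_converges[of "real s"] by (intro sum_le_suminf) (auto simp: sums_iff)
    also have "\<dots> = exp (real s)"
      using exp_converges[of "real s"] by (simp add: sums_iff)
    finally show ?thesis
      by (simp add: divide_inverse mult.commute)
  qed
  also have "exp (real s) = exp 1 ^ s"
    by (simp flip: exp_of_nat_mult)
  also have "\<dots> \<le> 3 ^ s"
    using exp_le by (intro power_mono) auto
  finally have s: "real s ^ s \<le> 3 ^ s * fact s"
    by (simp add: divide_le_eq)
  have "real n ^ s = (real n / real s) ^ s * real s ^ s"
    by (cases "s = 0") (simp_all add: power_divide)
  also have "\<dots> \<le> real (n choose s) * (3 ^ s * fact s)"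
    using binomial_ge_n_over_k_pow_k[OF assms(1), where 'a = real] s by (intro mult_mono) auto
  finally have "real n ^ s * fact (n - s) \<le> real (n choose s) * (3 ^ s * fact s) * fact (n - s)"
    by (intro mult_right_mono) auto
  also have "\<dots> = real (fact s * fact (n - s) * (n choose s)) * 3 ^ s"
    by simp
  also have "\<dots> = fact n * 3 ^ s"
    unfolding binomial_fact_lemma[OF assms(1)] by simp
  finally show ?thesis
    using assms(2) by (simp add: power_divide field_simps)
qed

section \<open>Coloured Hamilton cycles as a spread family\<close>

definition coloured_cycle :: "'a list \<times> 'c list \<Rightarrow> ('a set \<times> 'c) set" where
  "coloured_cycle = (\<lambda>(xs, cs). (\<lambda>i. (cycle_edge xs i, cs ! i)) ` {..<length xs})"

lemma fst_coloured_cycle: "fst ` coloured_cycle (xs, cs) = cycle_edge xs ` {..<length xs}"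
  unfolding coloured_cycle_def by (auto simp: image_image)

lemma inj_on_fst_coloured_cycle:
  assumes "distinct xs" "length xs \<ge> 3"
  shows "inj_on fst (coloured_cycle (xs, cs))"
proof (rule inj_onI)
  fix x y assume "x \<in> coloured_cycle (xs, cs)" "y \<in> coloured_cycle (xs, cs)" and eq: "fst x = fst y"
  then obtain i j where ij: "i < length xs" "x = (cycle_edge xs i, cs ! i)"
      "j < length xs" "y = (cycle_edge xs j, cs ! j)"
    unfolding coloured_cycle_def by auto
  then have "i = j"
    using inj_onD[OF inj_on_cycle_edge[OF assms], of i j] eq by simp
  with ij(2,4) show "x = y" by simp
qed

text \<open>With \<open>s = card S\<close>, at most \<open>4 ^ s * fact (n - s)\<close> vertex
  orders contain the edges of \<open>S\<close>, and each leaves at most \<open>fact (n - s)\<close>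
  colour orders. Each factorial is at most \<open>fact n * (3 / n) ^ s\<close>, and
  \<open>4 * 9 = 36\<close>.\<close>

lemma spread_coloured_cycles:
  assumes V: "finite V" "card V = n" and C: "finite C" "card C = n" and n: "n \<ge> 3"
  shows "spread (permutations_of_set V \<times> permutations_of_set C) coloured_cycle
    ((fact n)\<^sup>2) ((real n)\<^sup>2 / 36)"
  unfolding spread_def
proof (intro allI impI)
  fix S :: "('a set \<times> 'b) set" assume S: "finite S"
  let ?A = "{i \<in> permutations_of_set V \<times> permutations_of_set C. S \<subseteq> coloured_cycle i}"
  let ?s = "card S"
  show "real (card ?A) \<le> (fact n)\<^sup>2 / ((real n)\<^sup>2 / 36) ^ ?s"
  proof (cases "?A = {}")
    case True
    then show ?thesis by (simp only: card.empty) simp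
  next
    case False
    have P: "length xs = n" "distinct xs" if "xs \<in> permutations_of_set V" for xs
      using that permutations_of_setD length_finite_permutations_of_set V(2) by auto
    obtain xs cs where xs: "xs \<in> permutations_of_set V" "S \<subseteq> coloured_cycle (xs, cs)"
      using False by auto
    have inj: "inj_on fst S"
      using inj_on_fst_coloured_cycle[of xs cs] P[OF xs(1)] n xs(2) by (auto intro: inj_on_subset)
    define F where "F = fst ` S"
    \<comment> \<open>Here \<open>\<kappa>\<close> is the colour that \<open>S\<close> prescribes
      for an edge; it is unique because \<open>S\<close> lies in a coloured cycle.\<close>
    define \<kappa> where "\<kappa> e = (SOME c. (e, c) \<in> S)" for e
    have F: "finite F" "card F = ?s"
      unfolding F_def using S inj by (auto simp: card_image)
    have \<kappa>: "\<kappa> e = c" if "(e, c) \<in> S" for e c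
    proof -
      have "(e, \<kappa> e) \<in> S"
        unfolding \<kappa>_def using that by (rule someI)
      then show ?thesis
        using inj_onD[OF inj, of "(e, \<kappa> e)" "(e, c)"] that by simp
    qed
    have "F \<subseteq> cycle_edge xs ` {..<n}"
      using image_mono[OF xs(2), of fst] P[OF xs(1)] unfolding F_def fst_coloured_cycle by simp
    then have "card F \<le> n"
      using surj_card_le[of "{..<n}" F "cycle_edge xs"] by simp
    then have sn: "?s \<le> n" using F by simp
    let ?X = "{ys \<in> permutations_of_set V. F \<subseteq> cycle_edge ys ` {..<n}}"
    let ?J = "\<lambda>ys. {i \<in> {..<n}. cycle_edge ys i \<in> F}"
    let ?C = "\<lambda>ys. {ds \<in> permutations_of_set C. \<forall>i\<in>?J ys. i < n \<and> ds ! i = \<kappa> (cycle_edge ys i)}"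
    have sub: "?A \<subseteq> Sigma ?X ?C"
    proof
      fix i assume i: "i \<in> ?A"
      obtain ys ds where yd: "i = (ys, ds)" by (cases i)
      have ys: "ys \<in> permutations_of_set V" "ds \<in> permutations_of_set C" "S \<subseteq> coloured_cycle (ys, ds)"
        using i yd by auto
      have "F \<subseteq> cycle_edge ys ` {..<n}"
        using image_mono[OF ys(3), of fst] P[OF ys(1)] unfolding F_def fst_coloured_cycle by simp
      moreover have "ds ! k = \<kappa> (cycle_edge ys k)" if k: "k < n" "cycle_edge ys k \<in> F" for k
      proof -
        obtain c where c: "(cycle_edge ys k, c) \<in> S"
          using k(2) unfolding F_def by auto
        moreover have "(cycle_edge ys k, ds ! k) \<in> coloured_cycle (ys, ds)"
          unfolding coloured_cycle_def using k(1) P[OF ys(1)] by auto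
        ultimately have "c = ds ! k"
          using inj_onD[OF inj_on_fst_coloured_cycle[of ys ds], of "(cycle_edge ys k, c)" "(cycle_edge ys k, ds ! k)"]
            P[OF ys(1)] n ys(3) by auto
        with \<kappa>[OF c] show ?thesis by simp
      qed
      ultimately show "i \<in> Sigma ?X ?C"
        using ys yd by simp
    qed
    have "card ?A \<le> card (Sigma ?X ?C)"
      using sub by (rule card_mono[rotated]) (intro finite_SigmaI; simp)
    also have "\<dots> = (\<Sum>ys\<in>?X. card (?C ys))"
      by (rule card_SigmaI) auto
    also have "\<dots> \<le> (\<Sum>ys\<in>?X. fact (n - ?s))"
    proof (rule sum_mono)
      fix ys assume ys: "ys \<in> ?X"
      \<comment> \<open>As cycle edges at different positions differ, exactly \<open>card S\<close>
        positions of the colour list are prescribed.\<close>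
      have image: "cycle_edge ys ` ?J ys = F"
        using ys by auto
      have "inj_on (cycle_edge ys) (?J ys)"
        using inj_on_cycle_edge[of ys] P[of ys] ys n by (auto intro: inj_on_subset)
      then have "card (cycle_edge ys ` ?J ys) = card (?J ys)"
        by (rule card_image)
      then have "card (?J ys) = ?s"
        unfolding image F(2) by (rule sym)
      then show "card (?C ys) \<le> fact (n - ?s)"
        using card_permutations_prescribed[OF C(1), of "?J ys" "\<lambda>i. \<kappa> (cycle_edge ys i)"] C(2) by simp
    qed
    also have "\<dots> = card ?X * fact (n - ?s)"
      by simp
    also have "\<dots> \<le> 4 ^ ?s * fact (n - ?s) * fact (n - ?s)"
      using card_cycles_containing_le[OF V(1) _ F(1)] V(2) n F(2) by (intro mult_right_mono) auto
    finally have "real (card ?A) \<le> real (4 ^ ?s * fact (n - ?s) * fact (n - ?s))"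
      by (rule of_nat_mono)
    also have "\<dots> = 4 ^ ?s * (fact (n - ?s))\<^sup>2"
      by (simp add: power2_eq_square)
    also have "\<dots> \<le> 4 ^ ?s * (fact n * (3 / real n) ^ ?s)\<^sup>2"
      using fact_diff_le[OF sn] n by (intro mult_left_mono power_mono) auto
    also have "\<dots> = (fact n)\<^sup>2 / ((real n)\<^sup>2 / 36) ^ ?s"
    proof -
      have "(4::real) ^ ?s * 9 ^ ?s = 36 ^ ?s"
        by (simp flip: power_mult_distrib)
      moreover have "((3::real) ^ ?s)\<^sup>2 = 9 ^ ?s" "(real n ^ ?s)\<^sup>2 = ((real n)\<^sup>2) ^ ?s"
        by (simp_all flip: power_mult add: mult.commute[of _ 2]) (simp add: power_mult)
      ultimately show ?thesis
        using n by (simp add: power_mult_distrib power_divide field_simps)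
    qed
    finally show ?thesis .
  qed
qed

subsection \<open>Rainbow Hamilton cycles\<close>

lemma has_rainbow_hamilton_cycleI:
  assumes xs: "xs \<in> permutations_of_set {1..n}" and cs: "cs \<in> permutations_of_set {1..n}"
    and n: "n \<ge> 3" and sub: "coloured_cycle (xs, cs) \<subseteq> coloured_pairs G"
  shows "has_rainbow_hamilton_cycle n G"
proof -
  have len: "length xs = n" "distinct xs" "set xs = {1..n}" "length cs = n" "distinct cs"
    using permutations_of_setD[OF xs] permutations_of_setD[OF cs]
      length_finite_permutations_of_set[OF xs] length_finite_permutations_of_set[OF cs] by simp_all
  have H: "cycle_edges xs = cycle_edge xs ` {..<n}"
    unfolding cycle_edges_def using len by auto
  have col: "cycle_edge xs i \<in> fst G \<and> snd G (cycle_edge xs i) = cs ! i" if "i < n" for i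
    using sub that len(1) unfolding coloured_cycle_def coloured_pairs_def by fastforce
  have "inj_on (snd G) (cycle_edges xs)"
  proof (rule inj_onI)
    fix e e' assume "e \<in> cycle_edges xs" "e' \<in> cycle_edges xs" and eq: "snd G e = snd G e'"
    then obtain i k where "i < n" "e = cycle_edge xs i" "k < n" "e' = cycle_edge xs k"
      unfolding H by auto
    then show "e = e'"
      using eq col[of i] col[of k] len(4,5) by (auto simp: nth_eq_iff_index_eq)
  qed
  moreover have "hamilton_cycle {1..n} (fst G) (cycle_edges xs)"
    unfolding hamilton_cycle_def using len n col H by (intro exI[of _ xs]) auto
  ultimately show ?thesis
    unfolding has_rainbow_hamilton_cycle_def rainbow_def by blast
qed

lemma coloured_cycle_complete_edges:
  assumes xs: "xs \<in> permutations_of_set {1..n}" and cs: "cs \<in> permutations_of_set {1..n}"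
    and n: "n \<ge> 3"
  shows "coloured_cycle (xs, cs) \<subseteq> complete_edges n \<times> {1..n}" "card (coloured_cycle (xs, cs)) \<le> n"
proof -
  have len: "length xs = n" "distinct xs" "set xs = {1..n}" "length cs = n" "set cs = {1..n}"
    using permutations_of_setD[OF xs] permutations_of_setD[OF cs]
      length_finite_permutations_of_set[OF xs] length_finite_permutations_of_set[OF cs] by simp_all
  have "cycle_edge xs i \<in> complete_edges n \<and> cs ! i \<in> {1..n}" if i: "i < n" for i
  proof -
    have lt: "Suc i mod n < n" using n by (intro mod_less_divisor) linarith
    have "i \<noteq> Suc i mod n" using n i by (auto simp: mod_Suc)
    then have "xs ! i \<noteq> xs ! (Suc i mod n)"
      using len(1,2) i lt by (simp add: nth_eq_iff_index_eq)
    moreover have "xs ! i \<in> {1..n}" "xs ! (Suc i mod n) \<in> {1..n}" "cs ! i \<in> {1..n}"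
      using len i lt nth_mem by metis+
    ultimately show ?thesis
      unfolding complete_edges_def using len(1) by simp
  qed
  then show "coloured_cycle (xs, cs) \<subseteq> complete_edges n \<times> {1..n}"
    unfolding coloured_cycle_def using len(1) by auto
  show "card (coloured_cycle (xs, cs)) \<le> n"
    unfolding coloured_cycle_def using len(1) card_image_le[of "{..<n}"] by simp
qed

lemma prob_rainbow_hamilton_cycle_ge:
  assumes n: "n \<ge> 3" and M: "1 \<le> M" and p: "0 \<le> p" "p \<le> 1" "1764 * ln (real n) / real n \<le> p"
  shows "1 - (2 ^ M / ln (real n) + 2 * (1 / 4) ^ M) \<le>
    measure_pmf.prob (colored_binomial_graph n n p) {G. has_rainbow_hamilton_cycle n G}"
proof -
  let ?V = "{1..n}" and ?E = "complete_edges n"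
  let ?I = "permutations_of_set ?V \<times> permutations_of_set ?V"
  let ?F = "{W. \<exists>i\<in>?I. coloured_cycle i \<subseteq> W}"
  have E: "finite ?E"
    unfolding complete_edges_def by (rule finite_subset[of _ "Pow ?V"]) auto
  have q: "1764 * ln (real n) / (real n)\<^sup>2 \<le> p / n" "p / n < 1"
    using p n by (auto simp: power2_eq_square field_simps)
  \<comment> \<open>The normalisation equals the number of indices, so the lower bound from
    \<open>hits\<close> starts at 1.\<close>
  have I: "real (card ?I) / (fact n)\<^sup>2 = 1"
    by (simp add: card_cartesian_product power2_eq_square)
  have "1 - (2 ^ M / ln (real n) + 2 * (1 / 4) ^ M) \<le>
      hit_mean (?E \<times> ?V) (p / n) ?I coloured_cycle"
  proof -
    have "hits TYPE(nat list \<times> nat list) (?E \<times> ?V) ((fact n)\<^sup>2) ((real n)\<^sup>2 / 36) n (p / n)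
        (2 ^ M / ln (real n) + 2 * (1 / 4) ^ M)"
      using E by (intro hits_logarithmic n M q) auto
    from this[unfolded hits_def, rule_format, of ?I coloured_cycle "p / n"] show ?thesis
      unfolding I using spread_coloured_cycles[of ?V n ?V] coloured_cycle_complete_edges[OF _ _ n] n q by auto
  qed
  also have "\<dots> \<le> measure_pmf.prob (random_colouring ?E ?V 0 p) {G. coloured_pairs G \<in> ?F}"
  proof -
    have "single_coloured ?F"
    proof (rule single_coloured_upset)
      fix i assume "i \<in> ?I"
      then obtain xs cs where i: "i = (xs, cs)" "xs \<in> permutations_of_set ?V" by auto
      have "length xs = n" "distinct xs"
        using permutations_of_setD[OF i(2)] length_finite_permutations_of_set[OF i(2)] by simp_all
      then show "inj_on fst (coloured_cycle i)"
        unfolding i(1) using n by (intro inj_on_fst_coloured_cycle) auto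
    qed
    then show ?thesis
      using subset_mean_le_random_colouring[OF E _ _ p(1,2), of ?V ?F 0] n
      unfolding hit_mean_def by simp
  qed
  also have "\<dots> \<le> measure_pmf.prob (random_colouring ?E ?V 0 p) {G. has_rainbow_hamilton_cycle n G}"
    using has_rainbow_hamilton_cycleI[OF _ _ n]
    by (intro measure_pmf.finite_measure_mono) auto
  also have "random_colouring ?E ?V 0 p = colored_binomial_graph n n p"
    unfolding random_colouring_def colored_binomial_graph_def binomial_graph_def ..
  finally show ?thesis .
qed

theorem theorem1p3:
  shows "\<exists>K::real. K > 0 \<and>
    (\<forall>p :: nat \<Rightarrow> real.
       (\<forall>n. 0 \<le> p n \<and> p n \<le> 1) \<longrightarrow>
       (\<forall>\<^sub>F n in sequentially. p n \<ge> K * ln (real n) / real n) \<longrightarrow>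
       (\<lambda>n. measure_pmf.prob (colored_binomial_graph n n (p n))
              {G. has_rainbow_hamilton_cycle n G}) \<longlonglongrightarrow> 1)"
proof (intro exI[of _ 1764] conjI allI impI)
  fix p :: "nat \<Rightarrow> real"
  assume p: "\<forall>n. 0 \<le> p n \<and> p n \<le> 1" "\<forall>\<^sub>F n in sequentially. 1764 * ln (real n) / real n \<le> p n"
  show "(\<lambda>n. measure_pmf.prob (colored_binomial_graph n n (p n))
              {G. has_rainbow_hamilton_cycle n G}) \<longlonglongrightarrow> 1"
  proof (rule order_tendstoI)
    fix a :: real assume "a < 1"
    \<comment> \<open>The error consists of \<open>2 ^ M / ln n\<close> and two copies of
      \<open>(1 / 4) ^ M\<close>. First \<open>M\<close> and then \<open>n\<close> is taken large,
      making each of the three less than a quarter of \<open>1 - a\<close>.\<close>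
    then have a: "0 < (1 - a) / 4" by simp
    obtain M0 where M0: "(1 / 4 :: real) ^ M0 < (1 - a) / 4"
      using real_arch_pow_inv[OF a, of "1 / 4"] by auto
    define M where "M = Suc M0"
    have M: "1 \<le> M" "(1 / 4 :: real) ^ M < (1 - a) / 4"
      unfolding M_def using M0 by (auto intro: le_less_trans[rotated])
    have "((\<lambda>n. 2 ^ M / ln (real n)) \<longlonglongrightarrow> 0)"
      by (intro tendsto_divide_0[OF tendsto_const]
          filterlim_at_top_imp_at_infinity filterlim_compose[OF ln_at_top filterlim_real_sequentially])
    then have "\<forall>\<^sub>F n in sequentially. 2 ^ M / ln (real n) < (1 - a) / 4"
      using a by (rule order_tendstoD)
    with p(2) eventually_ge_at_top[of 3]
    show "\<forall>\<^sub>F n in sequentially. a < measure_pmf.prob (colored_binomial_graph n n (p n))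
              {G. has_rainbow_hamilton_cycle n G}"
    proof eventually_elim
      case (elim n)
      have "1 - (2 ^ M / ln (real n) + 2 * (1 / 4) ^ M) \<le> measure_pmf.prob (colored_binomial_graph n n (p n))
              {G. has_rainbow_hamilton_cycle n G}"
        using elim p(1) M(1) by (intro prob_rainbow_hamilton_cycle_ge) auto
      moreover have "a < 1 - (2 ^ M / ln (real n) + 2 * (1 / 4) ^ M)"
        using elim(3) M(2) \<open>a < 1\<close> by argo
      ultimately show ?case by linarith
    qed
  next
    fix a :: real assume "1 < a"
    then show "\<forall>\<^sub>F n in sequentially. measure_pmf.prob (colored_binomial_graph n n (p n))
              {G. has_rainbow_hamilton_cycle n G} < a"
      by (intro always_eventually allI le_less_trans[OF measure_pmf.prob_le_1])
  qed
qed simp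

end
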